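(* Let $d\ge 3$ be an integer and let $\lambda=\lceil\frac{d-2}{2}\rceil$. Let $g:[0,\pi]\to\mathbb{R}$ be a continuous function such that $g\in C^\lambda[0,\pi]$ and (i) $(-1)^\lambda g^{(\lambda)}$ is convex on $[0,\pi]$; (ii) $g^{(j)}(\pi)=0$ for $0\le j\le\lambda+1$, and $g^{(\lambda+1)}(0)$ is finite. Then $g$ is a positive definite function on $\mathbb{S}^{d-1}$. If, in addition, $g^{(\lambda)}$ is not a linear polynomial, then $g$ is a strictly positive definite function on $\mathbb{S}^{d-1}$.
   Context: $\mathbb{S}^{d-1}$ is the unit sphere of $\mathbb{R}^d$ with geodesic distance $\mathrm{d}(x,y)=\arccos\langle x,y\rangle$. A continuous function $g:[0,\pi]\to\mathbb{R}$ is positive definite (resp. strictly positive definite) on $\mathbb{S}^{d-1}$ if for every $N\in\mathbb{N}$ and all distinct points $x_1,\dots,x_N\in\mathbb{S}^{d-1}$ the $N\times N$ matrix $[g(\mathrm{d}(x_i,x_j))]_{i,j=1}^N$ is nonnegative definite (resp. positive definite). Derivatives at the endpoints $0$ and $\pi$ are one-sided; in particular $g^{(\lambda+1)}(0)$ and $g^{(\lambda+1)}(\pi)$ are the one-sided derivatives of $g^{(\lambda)}$ at $0$ and $\pi$. A linear polynomial means a polynomial of degree at most $1$. *)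

theory Defs
  imports "HOL-Analysis.Analysis" "HOL-Computational_Algebra.Polynomial"
begin

(* Geodesic distance; meaningful for unit vectors only. *)
definition geodesic_dist :: "'a::real_inner \<Rightarrow> 'a \<Rightarrow> real" where
  "geodesic_dist x y = arccos (inner x y)"

(* N x N matrices are functions of two indices in {1..N}, so that N can be
   quantified over. *)
definition symmetric_mat :: "nat \<Rightarrow> (nat \<Rightarrow> nat \<Rightarrow> real) \<Rightarrow> bool" where
  "symmetric_mat N A \<longleftrightarrow> (\<forall>i\<in>{1..N}. \<forall>j\<in>{1..N}. A i j = A j i)"

definition nonneg_definite_mat :: "nat \<Rightarrow> (nat \<Rightarrow> nat \<Rightarrow> real) \<Rightarrow> bool" where
  "nonneg_definite_mat N A \<longleftrightarrow> symmetric_mat N A \<and>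
     (\<forall>c :: nat \<Rightarrow> real. (\<Sum>i=1..N. \<Sum>j=1..N. c i * A i j * c j) \<ge> 0)"

definition pos_definite_mat :: "nat \<Rightarrow> (nat \<Rightarrow> nat \<Rightarrow> real) \<Rightarrow> bool" where
  "pos_definite_mat N A \<longleftrightarrow> symmetric_mat N A \<and>
     (\<forall>c :: nat \<Rightarrow> real. (\<exists>i\<in>{1..N}. c i \<noteq> 0) \<longrightarrow>
        (\<Sum>i=1..N. \<Sum>j=1..N. c i * A i j * c j) > 0)"

(* In the next two definitions S is a unit sphere, and only the values of g on
   {0..pi} matter. *)
definition pos_def_fun_on :: "'a::real_inner set \<Rightarrow> (real \<Rightarrow> real) \<Rightarrow> bool" where
  "pos_def_fun_on S g \<longleftrightarrow>
     (\<forall>N (x :: nat \<Rightarrow> 'a). x ` {1..N} \<subseteq> S \<and> inj_on x {1..N} \<longrightarrow>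
        nonneg_definite_mat N (\<lambda>i j. g (geodesic_dist (x i) (x j))))"

definition strictly_pos_def_fun_on :: "'a::real_inner set \<Rightarrow> (real \<Rightarrow> real) \<Rightarrow> bool" where
  "strictly_pos_def_fun_on S g \<longleftrightarrow>
     (\<forall>N (x :: nat \<Rightarrow> 'a). x ` {1..N} \<subseteq> S \<and> inj_on x {1..N} \<longrightarrow>
        pos_definite_mat N (\<lambda>i j. g (geodesic_dist (x i) (x j))))"

(* Iterated derivative relative to S, hence one-sided at the endpoints of a
   compact interval.  The library's deriv is two-sided, so it would depend on
   values outside S.  Where the derivative does not exist the value is
   unspecified; differentiability has to be required separately. *)
primrec higher_deriv_within :: "real set \<Rightarrow> nat \<Rightarrow> (real \<Rightarrow> real) \<Rightarrow> real \<Rightarrow> real" where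
  "higher_deriv_within S 0 f = f"
| "higher_deriv_within S (Suc n) f =
     (\<lambda>x. vector_derivative (higher_deriv_within S n f) (at x within S))"

definition C_k_within :: "nat \<Rightarrow> real set \<Rightarrow> (real \<Rightarrow> real) \<Rightarrow> bool" where
  "C_k_within k S f \<longleftrightarrow>
     (\<forall>j<k. higher_deriv_within S j f differentiable_on S) \<and>
     (\<forall>j\<le>k. continuous_on S (higher_deriv_within S j f))"

definition linear_poly_on :: "real set \<Rightarrow> (real \<Rightarrow> real) \<Rightarrow> bool" where
  "linear_poly_on S f \<longleftrightarrow> (\<exists>p :: real poly. degree p \<le> 1 \<and> (\<forall>x\<in>S. f x = poly p x))"

end

theory Submission
  imports Defs
begin

text \<open>
The sphere embeds isometrically in the unit sphere of dimension \<open>2 l + 1\<close>, whose zonal harmonics are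
multiples of the derivatives \<open>gegenbauer l n\<close> of Chebyshev polynomials. The weighted function
\<open>sin t ^ (2 l) * gegenbauer l n (cos t)\<close> is, up to a positive factor, \<open>(-1) ^ l\<close> times the divided
difference of \<open>s \<mapsto> cos (\<surd>s t)\<close> at the nodes \<open>(n + 2 k)\<^sup>2\<close>, \<open>k \<le> l\<close>; this is
\<open>weighted_gegenbauer l n\<close>. Its Laplace transform is
\<open>s / \<Prod>\<^sub>k (s\<^sup>2 + (n + 2 k)\<^sup>2)\<close>, so the transform of its \<open>(l + 2)\<close>-fold
antiderivative \<open>integrated_gegenbauer l n\<close> is
\<open>\<Prod>\<^sub>k 1 / (s (s\<^sup>2 + (n + 2 k)\<^sup>2))\<close>. Hence \<open>integrated_gegenbauer l n\<close> is a
convolution of the nonnegative functions \<open>(1 - cos (m t)) / m\<^sup>2\<close>, \<open>m = n + 2 k\<close>. Integrating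
by parts \<open>l + 2\<close> times, the Gegenbauer coefficients of \<open>g\<close> are integrals of
\<open>integrated_gegenbauer l n\<close> against the nonnegative second derivative (in the sense of measures) of
the convex function \<open>(-1) ^ l g\<^sup>(\<^sup>l\<^sup>)\<close>. So they are nonnegative, positive unless
\<open>g\<^sup>(\<^sup>l\<^sup>)\<close> vanishes, and small enough for the Gegenbauer series to converge
uniformly to \<open>g\<close>. The kernels \<open>gegenbauer l n (x \<bullet> y)\<close> are Gram matrices of harmonic
polynomials for the Fischer inner product, which gives positive definiteness of \<open>g\<close>.
\<close>

section \<open>Zonal harmonics and the Fischer inner product\<close>

text \<open>Polynomials are given by coefficient functions of arbitrary support; the Fischer product of degree
  \<open>n\<close> reads only the homogeneous parts of degree \<open>n\<close>.\<close>

type_synonym 'i fseries = "('i \<Rightarrow> nat) \<Rightarrow> real"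

definition mul_var :: "'i \<Rightarrow> 'i fseries \<Rightarrow> 'i fseries" where
  "mul_var i p = (\<lambda>m. if m i = 0 then 0 else p (m(i := m i - 1)))"

definition partial :: "'i \<Rightarrow> 'i fseries \<Rightarrow> 'i fseries" where
  "partial i p = (\<lambda>m. real (m i + 1) * p (m(i := m i + 1)))"

definition const_one :: "'i fseries" where
  "const_one = (\<lambda>m. if m = (\<lambda>_. 0) then 1 else 0)"

definition mul_lin :: "('i::finite \<Rightarrow> real) \<Rightarrow> 'i fseries \<Rightarrow> 'i fseries" where
  "mul_lin y p = (\<lambda>m. \<Sum>i\<in>UNIV. y i * mul_var i p m)"

definition mul_sq :: "'i::finite fseries \<Rightarrow> 'i fseries" where
  "mul_sq p = (\<lambda>m. \<Sum>i\<in>UNIV. mul_var i (mul_var i p) m)"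

definition laplacian :: "'i::finite fseries \<Rightarrow> 'i fseries" where
  "laplacian p = (\<lambda>m. \<Sum>i\<in>UNIV. partial i (partial i p) m)"

text \<open>In formal variables X this is the polynomial |X|^(2k) (y . X)^j, homogeneous of degree
  2k + j.\<close>

definition zonal :: "nat \<Rightarrow> nat \<Rightarrow> ('i::finite \<Rightarrow> real) \<Rightarrow> 'i fseries" where
  "zonal k j y = (mul_sq ^^ k) ((mul_lin y ^^ j) const_one)"

section \<open>Multiplication and differentiation operators on coefficient functions\<close>

lemma zonal_0_0: "zonal 0 0 y = const_one"
  and zonal_Suc: "zonal (Suc k) j y = mul_sq (zonal k j y)"
  and zonal_0_Suc: "zonal 0 (Suc j) y = mul_lin y (zonal 0 j y)"
  by (simp_all add: zonal_def)

lemma mul_var_commute: "mul_var i (mul_var j p) = mul_var j (mul_var i p)"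
  by (rule ext) (auto simp: mul_var_def fun_upd_twist)

text \<open>The canonical commutation relation; the later product rules reduce to it.\<close>

lemma partial_mul_var:
  "partial i (mul_var j p) = (\<lambda>m. mul_var j (partial i p) m + (if i = j then p m else 0))"
proof (rule ext)
  fix m :: "'a \<Rightarrow> nat"
  have "m(j := 0) = m" if "m j = 0" using that by auto
  then show "partial i (mul_var j p) m = mul_var j (partial i p) m + (if i = j then p m else 0)"
    by (auto simp: partial_def mul_var_def fun_upd_twist algebra_simps)
qed

lemma mul_var_sum: "mul_var i (\<lambda>m. \<Sum>a\<in>A. f a m) = (\<lambda>m. \<Sum>a\<in>A. mul_var i (f a) m)"
  and partial_sum: "partial i (\<lambda>m. \<Sum>a\<in>A. f a m) = (\<lambda>m. \<Sum>a\<in>A. partial i (f a) m)"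
  and mul_var_add: "mul_var i (\<lambda>m. p m + q m) = (\<lambda>m. mul_var i p m + mul_var i q m)"
  and partial_add: "partial i (\<lambda>m. p m + q m) = (\<lambda>m. partial i p m + partial i q m)"
  and mul_var_scale: "mul_var i (\<lambda>m. c * p m) = (\<lambda>m. c * mul_var i p m)"
  and partial_scale: "partial i (\<lambda>m. c * p m) = (\<lambda>m. c * partial i p m)"
  by (auto simp: mul_var_def partial_def sum_distrib_left algebra_simps)

lemma mul_var_if: "mul_var i (\<lambda>m. if b then p m else 0) = (\<lambda>m. if b then mul_var i p m else 0)"
  by (auto simp: mul_var_def)

lemma partial_const_one: "partial i const_one = (\<lambda>m. 0)"
  by (auto simp: partial_def const_one_def fun_eq_iff)

lemma mul_lin_scale: "mul_lin y (\<lambda>m. c * p m) = (\<lambda>m. c * mul_lin y p m)"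
  and mul_sq_scale: "mul_sq (\<lambda>m. c * p m) = (\<lambda>m. c * mul_sq p m)"
  and mul_sq_add: "mul_sq (\<lambda>m. p m + q m) = (\<lambda>m. mul_sq p m + mul_sq q m)"
  by (simp_all add: mul_lin_def mul_sq_def mul_var_scale mul_var_add sum_distrib_left sum.distrib
      algebra_simps)

lemma mul_sq_mul_var: "mul_sq (mul_var i p) = mul_var i (mul_sq p)"
  by (simp add: mul_sq_def mul_var_sum mul_var_commute[of i])

lemma partial_mul_lin:
  "partial i (mul_lin y p) = (\<lambda>m. mul_lin y (partial i p) m + y i * p m)"
proof
  fix m
  have "partial i (mul_lin y p) m
      = (\<Sum>j\<in>UNIV. y j * mul_var j (partial i p) m + (if i = j then y j * p m else 0))"
    by (auto simp: mul_lin_def partial_sum partial_scale partial_mul_var distrib_left intro!: sum.cong)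
  then show "partial i (mul_lin y p) m = mul_lin y (partial i p) m + y i * p m"
    by (simp add: sum.distrib mul_lin_def)
qed

lemma partial_mul_sq:
  "partial i (mul_sq p) = (\<lambda>m. mul_sq (partial i p) m + 2 * mul_var i p m)"
proof
  fix m
  have "partial i (mul_sq p) m
      = (\<Sum>j\<in>UNIV. mul_var j (mul_var j (partial i p)) m + (if i = j then 2 * mul_var i p m else 0))"
    by (auto simp: mul_sq_def partial_sum partial_mul_var mul_var_add mul_var_if intro!: sum.cong)
  then show "partial i (mul_sq p) m = mul_sq (partial i p) m + 2 * mul_var i p m"
    by (simp add: sum.distrib mul_sq_def)
qed

lemma partial_zonal_0:
  "partial i (zonal 0 j y) = (\<lambda>m. real j * y i * zonal 0 (j - 1) y m)"
proof (induction j)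
  case 0
  show ?case by (simp add: zonal_0_0 partial_const_one)
next
  case (Suc j)
  have "mul_lin y (zonal 0 (j - 1) y) = zonal 0 j y" if "j \<noteq> 0"
    using that by (cases j) (simp_all add: zonal_0_Suc)
  then show ?case
    unfolding zonal_0_Suc partial_mul_lin Suc.IH mul_lin_scale
    by (cases "j = 0") (simp_all add: algebra_simps)
qed

lemma partial_zonal:
  "partial i (zonal k j y) = (\<lambda>m. 2 * real k * mul_var i (zonal (k - 1) j y) m
     + real j * y i * zonal k (j - 1) y m)"
proof (induction k)
  case 0
  then show ?case by (simp add: partial_zonal_0)
next
  case (Suc k)
  have "mul_sq (zonal (k - 1) j y) = zonal k j y" if "k \<noteq> 0"
    using that by (cases k) (simp_all add: zonal_Suc)
  then show ?case
    unfolding zonal_Suc partial_mul_sq Suc.IH mul_sq_add mul_sq_scale mul_sq_mul_var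
    by (cases "k = 0") (simp_all add: algebra_simps)
qed

lemma mul_lin_mul_sq: "mul_lin y (mul_sq p) = mul_sq (mul_lin y p)"
  by (simp add: mul_lin_def mul_sq_def mul_var_sum mul_var_scale sum_distrib_left)
     (subst sum.swap, simp add: mul_var_commute)

lemma mul_lin_zonal: "mul_lin y (zonal k j y) = zonal k (Suc j) y"
  by (induction k) (simp_all add: zonal_Suc zonal_0_Suc mul_lin_mul_sq)

text \<open>Two applications of \<open>partial_zonal\<close>, summed over the variables, leave
  contractions: X_i X_i gives |X|^2, y_i X_i gives the linear form, y_i y_i gives 1, and the
  commutators count the variables.\<close>

lemma laplacian_zonal:
  fixes y :: "'i::finite \<Rightarrow> real"
  assumes "(\<Sum>i\<in>UNIV. (y i)\<^sup>2) = 1"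
  shows "laplacian (zonal k j y) = (\<lambda>m.
      2 * real k * (2 * real k - 2 + real CARD('i) + 2 * real j) * zonal (k - 1) j y m
      + real j * (real j - 1) * zonal k (j - 2) y m)"
proof
  fix m :: "'i \<Rightarrow> nat"
  have sq: "(\<Sum>i\<in>UNIV. mul_var i (mul_var i (zonal (k - 2) j y)) m) = zonal (k - 1) j y m" if k2: "k \<ge> 2"
  proof -
    obtain k' where "k = Suc (Suc k')" using k2 le_Suc_ex[of 2 k] by auto
    then show ?thesis by (simp add: zonal_Suc mul_sq_def)
  qed
  have lin: "(\<Sum>i\<in>UNIV. y i * mul_var i (zonal (k - 1) (j - 1) y) m) = zonal (k - 1) j y m" if "j \<ge> 1"
    using that mul_lin_zonal[of y "k - 1" "j - 1"] by (simp add: mul_lin_def fun_eq_iff)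
  have "laplacian (zonal k j y) m = (\<Sum>i\<in>UNIV.
      2 * real k * (2 * real (k - 1) * mul_var i (mul_var i (zonal (k - 2) j y)) m
         + real j * (y i * mul_var i (zonal (k - 1) (j - 1) y) m) + zonal (k - 1) j y m)
      + real j * (2 * real k * (y i * mul_var i (zonal (k - 1) (j - 1) y) m)
         + real (j - 1) * (y i)\<^sup>2 * zonal k (j - 2) y m))"
    unfolding laplacian_def
  proof (intro sum.cong refl)
    fix i
    have "partial i (partial i (zonal k j y)) m = 2 * real k * (2 * real (k - 1)
        * mul_var i (mul_var i (zonal (k - 1 - 1) j y)) m
        + real j * y i * mul_var i (zonal (k - 1) (j - 1) y) m + zonal (k - 1) j y m)
      + real j * y i * (2 * real k * mul_var i (zonal (k - 1) (j - 1) y) m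
        + real (j - 1) * y i * zonal k (j - 1 - 1) y m)"
      by (simp only: partial_zonal partial_add partial_scale partial_mul_var mul_var_add mul_var_scale
          if_True simp_thms)
    then show "partial i (partial i (zonal k j y)) m
      = 2 * real k * (2 * real (k - 1) * mul_var i (mul_var i (zonal (k - 2) j y)) m
         + real j * (y i * mul_var i (zonal (k - 1) (j - 1) y) m) + zonal (k - 1) j y m)
      + real j * (2 * real k * (y i * mul_var i (zonal (k - 1) (j - 1) y) m)
         + real (j - 1) * (y i)\<^sup>2 * zonal k (j - 2) y m)"
      by (simp add: numeral_2_eq_2 algebra_simps power2_eq_square)
  qed
  also have "\<dots> = 2 * real k * (2 * real (k - 1) * (\<Sum>i\<in>UNIV. mul_var i (mul_var i (zonal (k - 2) j y)) m)
       + real j * (\<Sum>i\<in>UNIV. y i * mul_var i (zonal (k - 1) (j - 1) y) m)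
       + real CARD('i) * zonal (k - 1) j y m)
      + real j * (2 * real k * (\<Sum>i\<in>UNIV. y i * mul_var i (zonal (k - 1) (j - 1) y) m)
         + real (j - 1) * (\<Sum>i\<in>UNIV. (y i)\<^sup>2) * zonal k (j - 2) y m)"
    by (simp only: sum.distrib sum_distrib_left[symmetric] sum_distrib_right[symmetric] sum_constant)
  also have "\<dots> = 2 * real k * (2 * (real k - 1) * zonal (k - 1) j y m + real j * zonal (k - 1) j y m
       + real CARD('i) * zonal (k - 1) j y m)
      + real j * (2 * real k * zonal (k - 1) j y m + (real j - 1) * zonal k (j - 2) y m)"
  proof -
    \<comment> \<open>Truncated subtraction makes k - 2 and j - 1 meaningless for small k or j;
      there the scalar factors vanish on both sides.\<close>
    have 1: "real k * (real (k - 1) * (\<Sum>i\<in>UNIV. mul_var i (mul_var i (zonal (k - 2) j y)) m))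
      = real k * ((real k - 1) * zonal (k - 1) j y m)"
    proof (cases "k \<ge> 2")
      case True
      then show ?thesis by (simp only: sq) (simp add: of_nat_diff)
    next
      case False
      then have "k = 0 \<or> k = 1" by auto
      then show ?thesis by auto
    qed
    have 2: "real j * (\<Sum>i\<in>UNIV. y i * mul_var i (zonal (k - 1) (j - 1) y) m) = real j * zonal (k - 1) j y m"
      using lin by (cases "j = 0") auto
    have 3: "real j * real (j - 1) = real j * (real j - 1)"
      by (cases j) auto
    have e1: "2 * K * (2 * K' * s + J * t + D * z) + J * (2 * K * t + J' * 1 * w)
        = 4 * (K * (K' * s)) + 4 * K * (J * t) + 2 * K * D * z + J * J' * w" for K K' J J' D s t z w :: real
      by (simp add: algebra_simps)
    have e2: "2 * K * (2 * (K - 1) * z + J * z + D * z) + J * (2 * K * z + (J - 1) * w)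
        = 4 * (K * ((K - 1) * z)) + 4 * K * (J * z) + 2 * K * D * z + J * (J - 1) * w" for K J D z w :: real
      by (simp add: algebra_simps)
    show ?thesis unfolding assms e2 by (rule trans[OF e1]) (simp only: 1 2 3)
  qed
  finally show "laplacian (zonal k j y) m = 2 * real k * (2 * real k - 2 + real CARD('i) + 2 * real j)
      * zonal (k - 1) j y m + real j * (real j - 1) * zonal k (j - 2) y m"
    by (simp add: algebra_simps)
qed

text \<open>Unfolded, this sums products of n-th partial derivatives at 0 over all words of n
  variables, which is n! times the sum of m! p_m q_m over exponents m of total degree n. The form
  over words is visibly positive semidefinite.\<close>

primrec fischer :: "nat \<Rightarrow> 'i::finite fseries \<Rightarrow> 'i fseries \<Rightarrow> real" where
  "fischer 0 p q = p (\<lambda>_. 0) * q (\<lambda>_. 0)"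
| "fischer (Suc n) p q = (\<Sum>i\<in>UNIV. fischer n (partial i p) (partial i q))"

lemma fischer_sym: "fischer n p q = fischer n q p"
  by (induction n arbitrary: p q) auto

lemma fischer_nonneg: "fischer n p p \<ge> 0"
  by (induction n arbitrary: p) (auto intro!: sum_nonneg)

lemma fischer_add_left: "fischer n (\<lambda>m. p m + p' m) q = fischer n p q + fischer n p' q"
  by (induction n arbitrary: p p' q) (auto simp: algebra_simps partial_add sum.distrib)

lemma fischer_scale_left: "fischer n (\<lambda>m. c * p m) q = c * fischer n p q"
  by (induction n arbitrary: p q) (auto simp: partial_scale sum_distrib_left)

lemma fischer_zero_left: "fischer n (\<lambda>m. 0) q = 0"
  using fischer_scale_left[of n 0 "\<lambda>_. 0" q] by simp

lemma fischer_sum_left: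
  "fischer n (\<lambda>m. \<Sum>a\<in>A. f a m) q = (\<Sum>a\<in>A. fischer n (f a) q)"
  by (induction A rule: infinite_finite_induct) (auto simp: fischer_zero_left fischer_add_left)

lemma fischer_scale_right: "fischer n p (\<lambda>m. c * q m) = c * fischer n p q"
  and fischer_sum_right: "fischer n p (\<lambda>m. \<Sum>a\<in>A. f a m) = (\<Sum>a\<in>A. fischer n p (f a))"
  by (simp_all add: fischer_sym[of n p] fischer_scale_left fischer_sum_left)

text \<open>Multiplication by a variable is adjoint to differentiation. At each degree the
  commutator contributes one more copy of the pairing, which accounts for the factor
  \<open>Suc n\<close>.\<close>

lemma fischer_mul_var:
  "fischer (Suc n) (mul_var i p) q = real (Suc n) * fischer n p (partial i q)"
proof (induction n arbitrary: p q)
  case 0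
  have "mul_var i r (\<lambda>_. 0) = 0" for r :: "'a fseries" by (simp add: mul_var_def)
  then show ?case by (simp add: partial_mul_var if_distrib if_distribR cong: if_cong)
next
  case (Suc n)
  have comm: "partial i (partial j q) = partial j (partial i q)" for j
    by (rule ext) (auto simp: partial_def fun_upd_twist)
  have "fischer (Suc (Suc n)) (mul_var i p) q
      = (\<Sum>j\<in>UNIV. fischer (Suc n) (mul_var i (partial j p)) (partial j q)
          + (if j = i then fischer (Suc n) p (partial j q) else 0))"
    unfolding fischer.simps(2)[of "Suc n"]
    by (intro sum.cong refl) (auto simp: partial_mul_var fischer_add_left fischer_zero_left simp del: fischer.simps)
  also have "\<dots> = real (Suc n) * (\<Sum>j\<in>UNIV. fischer n (partial j p) (partial j (partial i q)))
      + fischer (Suc n) p (partial i q)"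
    by (simp add: sum.distrib Suc comm sum_distrib_left del: fischer.simps)
  finally show ?case by (simp add: algebra_simps)
qed

text \<open>Both multiplications by X_i move across as derivatives. Consequently harmonic
  polynomials are orthogonal to every multiple of |X|^2.\<close>

lemma fischer_mul_sq:
  "fischer (Suc (Suc n)) (mul_sq p) q = real (Suc (Suc n)) * real (Suc n) * fischer n p (laplacian q)"
  by (simp add: mul_sq_def laplacian_def fischer_sum_left fischer_sum_right fischer_mul_var
      sum_distrib_left mult.assoc del: fischer.simps of_nat_Suc)

lemma fischer_mul_lin:
  "fischer (Suc n) (mul_lin y p) q = real (Suc n) * (\<Sum>i\<in>UNIV. y i * fischer n p (partial i q))"
  by (simp add: mul_lin_def fischer_sum_left fischer_scale_left fischer_mul_var
      sum_distrib_left mult_ac del: fischer.simps of_nat_Suc)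

text \<open>Pairing with (y . X)^n is, up to (n!)^2, evaluation at y of homogeneous polynomials of
  degree n; this is the case of a power of a linear form.\<close>

lemma fischer_zonal_0:
  "fischer n (zonal 0 n y) (zonal 0 n z) = (fact n)\<^sup>2 * (\<Sum>i\<in>UNIV. y i * z i) ^ n"
proof (induction n)
  case 0
  show ?case by (simp add: zonal_0_0 const_one_def)
next
  case (Suc n)
  have "fischer (Suc n) (zonal 0 (Suc n) y) (zonal 0 (Suc n) z)
      = (real (Suc n))\<^sup>2 * (\<Sum>i\<in>UNIV. y i * z i) * fischer n (zonal 0 n y) (zonal 0 n z)"
    unfolding zonal_0_Suc[of n y] fischer_mul_lin
    by (simp add: partial_zonal_0 fischer_scale_right sum_distrib_left sum_distrib_right
        power2_eq_square mult_ac del: fischer.simps of_nat_Suc)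
  then show ?case by (simp add: Suc power_mult_distrib mult_ac del: fischer.simps of_nat_Suc)
qed

text \<open>Each |X|^2 moves across as a Laplacian, which lowers the power of (y . X) by 2 because y
  is a unit vector. The result is again evaluation at y, where |X|^2 equals 1.\<close>

lemma fischer_zonal:
  fixes y :: "'i::finite \<Rightarrow> real"
  assumes "(\<Sum>i\<in>UNIV. (y i)\<^sup>2) = 1"
  shows "fischer (2 * k + j) (zonal k j z) (zonal 0 (2 * k + j) y)
     = (fact (2 * k + j))\<^sup>2 * (\<Sum>i\<in>UNIV. y i * z i) ^ j"
proof (induction k)
  case 0
  then show ?case by (simp add: fischer_zonal_0 mult.commute)
next
  case (Suc k)
  define n where "n = 2 * k + j"
  have "fischer (Suc (Suc n)) (mul_sq (zonal k j z)) (zonal 0 (Suc (Suc n)) y)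
      = real (Suc (Suc n)) * real (Suc n) * (real (Suc (Suc n)) * (real (Suc (Suc n)) - 1)
          * fischer n (zonal k j z) (zonal 0 n y))"
    unfolding fischer_mul_sq laplacian_zonal[OF assms] by (simp add: fischer_scale_right)
  also have "\<dots> = (fact (Suc (Suc n)))\<^sup>2 * (\<Sum>i\<in>UNIV. y i * z i) ^ j"
    by (simp add: Suc[folded n_def] power2_eq_square)
  finally show ?case by (simp add: n_def zonal_Suc)
qed

text \<open>The homogenization to degree n of the polynomial with coefficients \<open>a\<close>: u^j
  becomes (y . X)^j |X|^(n - j). Only exponents of the parity of n occur.\<close>

definition harmonic_zonal :: "nat \<Rightarrow> (nat \<Rightarrow> real) \<Rightarrow> ('i::finite \<Rightarrow> real) \<Rightarrow> 'i fseries" where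
  "harmonic_zonal n a y = (\<lambda>m. \<Sum>k\<le>n div 2. a (n - 2 * k) * zonal k (n - 2 * k) y m)"

lemma laplacian_sum_scale:
  "laplacian (\<lambda>m. \<Sum>k\<in>K. c k * f k m) = (\<lambda>m. \<Sum>k\<in>K. c k * laplacian (f k) m)"
proof
  fix m
  show "laplacian (\<lambda>m. \<Sum>k\<in>K. c k * f k m) m = (\<Sum>k\<in>K. c k * laplacian (f k) m)"
    unfolding laplacian_def
    by (simp add: partial_sum partial_scale sum_distrib_left) (rule sum.swap)
qed

text \<open>The Laplacian spreads each summand over two neighbouring \<open>zonal\<close> terms; the
  recurrence for \<open>a\<close> says that the contributions to each term cancel.\<close>

lemma laplacian_harmonic_zonal:
  fixes y :: "'i::finite \<Rightarrow> real" and a :: "nat \<Rightarrow> real"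
  assumes y: "(\<Sum>i\<in>UNIV. (y i)\<^sup>2) = 1"
    and a: "\<And>j. j + 2 \<le> n \<Longrightarrow> real (j + 2) * real (j + 1) * a (j + 2)
              = (real j - real n) * (real j + real n + real CARD('i) - 2) * a j"
  shows "laplacian (harmonic_zonal n a y) = (\<lambda>m. 0)"
proof
  fix m
  define K where "K = n div 2"
  define F where "F k = a (n - 2 * k) * (real (n - 2 * k) * (real (n - 2 * k) - 1)) * zonal k (n - 2 * k - 2) y m" for k
  define G where "G k = a (n - 2 * k) * (2 * real k * (2 * real k - 2 + real CARD('i) + 2 * real (n - 2 * k)))
     * zonal (k - 1) (n - 2 * k) y m" for k
  have "laplacian (harmonic_zonal n a y) m = (\<Sum>k\<le>K. G k + F k)"
    unfolding harmonic_zonal_def laplacian_sum_scale laplacian_zonal[OF y] K_def F_def G_def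
    by (intro sum.cong refl) (simp add: algebra_simps)
  also have "\<dots> = (\<Sum>k\<le>K. G k) + (\<Sum>k\<le>K. F k)"
    by (rule sum.distrib)
  \<comment> \<open>The last summand has exponent 0 or 1 in the linear form, so \<open>F K\<close>
    vanishes; so does \<open>G 0\<close> below, and the shifted sums pair off.\<close>
  also have "(\<Sum>k\<le>K. F k) = (\<Sum>k<K. F k)"
  proof -
    have "n - 2 * K = 0 \<or> n - 2 * K = 1" unfolding K_def by auto
    then have "F K = 0" by (auto simp: F_def)
    then show ?thesis by (simp add: lessThan_Suc_atMost[symmetric])
  qed
  also have "(\<Sum>k\<le>K. G k) = (\<Sum>k<K. G (Suc k))"
  proof -
    have "G 0 = 0" by (simp add: G_def)
    then show ?thesis
      by (simp only: lessThan_Suc_atMost[symmetric] sum.lessThan_Suc_shift)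
  qed
  also have "(\<Sum>k<K. G (Suc k)) + (\<Sum>k<K. F k) = (\<Sum>k<K. G (Suc k) + F k)"
    by (simp add: sum.distrib)
  also have "\<dots> = 0"
  proof (rule sum.neutral, rule ballI)
    fix k assume "k \<in> {..<K}"
    then have k: "2 * k + 2 \<le> n" by (auto simp: K_def)
    define j where "j = n - 2 * k - 2"
    have n: "n = 2 * k + j + 2" using k by (simp add: j_def)
    have j: "n - 2 * k = j + 2" "n - 2 * Suc k = j" using n by auto
    have rn: "real n = 2 * real k + real j + 2" using n by simp
    have e: "real (j + 2) * real (j + 1) * a (j + 2)
              = (real j - real n) * (real j + real n + real CARD('i) - 2) * a j"
      using a[of j] n by simp
    have "G (Suc k) + F k = (a j * (2 * real (Suc k) * (2 * real (Suc k) - 2 + real CARD('i) + 2 * real j))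
        + real (j + 2) * real (j + 1) * a (j + 2)) * zonal k j y m"
      unfolding G_def F_def j by (simp add: algebra_simps)
    also have "\<dots> = 0" unfolding e rn by (simp add: algebra_simps)
    finally show "G (Suc k) + F k = 0" .
  qed
  finally show "laplacian (harmonic_zonal n a y) m = 0" .
qed

text \<open>Since the second argument is harmonic, only the summand \<open>a n\<close> (y . X)^n of
  the first, free of |X|^2, survives; pairing with it evaluates the second argument at y.\<close>

lemma fischer_harmonic_zonal:
  fixes y z :: "'i::finite \<Rightarrow> real" and a :: "nat \<Rightarrow> real"
  assumes y: "(\<Sum>i\<in>UNIV. (y i)\<^sup>2) = 1" and z: "(\<Sum>i\<in>UNIV. (z i)\<^sup>2) = 1"
    and a: "\<And>j. j + 2 \<le> n \<Longrightarrow> real (j + 2) * real (j + 1) * a (j + 2)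
              = (real j - real n) * (real j + real n + real CARD('i) - 2) * a j"
  shows "fischer n (harmonic_zonal n a y) (harmonic_zonal n a z)
     = a n * (fact n)\<^sup>2 * (\<Sum>k\<le>n div 2. a (n - 2 * k) * (\<Sum>i\<in>UNIV. y i * z i) ^ (n - 2 * k))"
proof -
  let ?h = "harmonic_zonal n a z"
  have lap: "laplacian ?h = (\<lambda>m. 0)" by (rule laplacian_harmonic_zonal[OF z]) (rule a)
  have van: "fischer n (zonal k (n - 2 * k) y) ?h = 0" if k: "k \<noteq> 0" "k \<le> n div 2" for k
  proof -
    obtain k' where k': "k = Suc k'" using k(1) not0_implies_Suc by blast
    obtain n' where n': "n = Suc (Suc n')"
      using k k' by (cases n; cases "n - 1") auto
    have "fischer (Suc (Suc n')) (mul_sq (zonal k' (n - 2 * k) y)) ?h = 0"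
      unfolding fischer_mul_sq lap
      by (subst fischer_sym) (simp add: fischer_zero_left)
    then show ?thesis by (simp add: n' k' zonal_Suc)
  qed
  have "fischer n (harmonic_zonal n a y) ?h
      = (\<Sum>k\<le>n div 2. a (n - 2 * k) * fischer n (zonal k (n - 2 * k) y) ?h)"
    by (subst harmonic_zonal_def) (simp add: fischer_sum_left fischer_scale_left)
  also have "\<dots> = (\<Sum>k\<in>{0}. a (n - 2 * k) * fischer n (zonal k (n - 2 * k) y) ?h)"
    by (rule sum.mono_neutral_right) (auto simp: van)
  also have "\<dots> = a n * (\<Sum>k\<le>n div 2. a (n - 2 * k) * fischer n (zonal k (n - 2 * k) z) (zonal 0 n y))"
    by (simp add: harmonic_zonal_def fischer_sum_right fischer_scale_right)
      (simp add: fischer_sym[of n "zonal 0 n y"])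
  also have "(\<Sum>k\<le>n div 2. a (n - 2 * k) * fischer n (zonal k (n - 2 * k) z) (zonal 0 n y))
     = (\<Sum>k\<le>n div 2. a (n - 2 * k) * ((fact n)\<^sup>2 * (\<Sum>i\<in>UNIV. y i * z i) ^ (n - 2 * k)))"
  proof (rule sum.cong[OF refl])
    fix k assume "k \<in> {..n div 2}"
    then have "2 * k + (n - 2 * k) = n" by auto
    then show "a (n - 2 * k) * fischer n (zonal k (n - 2 * k) z) (zonal 0 n y)
      = a (n - 2 * k) * ((fact n)\<^sup>2 * (\<Sum>i\<in>UNIV. y i * z i) ^ (n - 2 * k))"
      using fischer_zonal[OF y, of k "n - 2 * k" z] by simp
  qed
  finally show ?thesis by (simp add: sum_distrib_left algebra_simps)
qed

text \<open>The hypothesis on the coefficients says that \<open>p\<close> solves the Gegenbauer equation, that is,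
  that the homogenization of \<open>p\<close> is harmonic.\<close>

lemma gegenbauer_kernel_nonneg:
  fixes x :: "nat \<Rightarrow> 'i::finite \<Rightarrow> real" and p :: "real poly"
  assumes x: "\<And>r. r \<in> A \<Longrightarrow> (\<Sum>i\<in>UNIV. (x r i)\<^sup>2) = 1"
    and deg: "degree p = n" and lead: "coeff p n > 0"
    and rec: "\<And>j. real (j + 2) * real (j + 1) * coeff p (j + 2)
              = (real j - real n) * (real j + real n + real CARD('i) - 2) * coeff p j"
    and card: "CARD('i) \<ge> 2"
  shows "(\<Sum>r\<in>A. \<Sum>s\<in>A. c r * poly p (\<Sum>i\<in>UNIV. x r i * x s i) * c s) \<ge> 0"
proof -
  define a where "a = coeff p"
  \<comment> \<open>Downward induction from j = n - 1, where coefficient n + 1 vanishes by the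
    degree; for j < n the factor of \<open>coeff p j\<close> in the recurrence is nonzero.\<close>
  have parity: "a j = 0" if "j \<le> n" "odd (n - j)" for j
    using that
  proof (induction "n - j" arbitrary: j rule: less_induct)
    case less
    have jn: "j < n" using less.prems by (cases "j = n") auto
    have "a (j + 2) = 0"
    proof (cases "j + 2 \<le> n")
      case True
      then show ?thesis using less.hyps[of "j + 2"] less.prems by auto
    next
      case False
      then show ?thesis using deg by (auto simp: a_def coeff_eq_0)
    qed
    then have "(real j - real n) * (real j + real n + real CARD('i) - 2) * a j = 0"
      using rec[of j] by (simp add: a_def)
    moreover have "real j - real n \<noteq> 0" "real j + real n + real CARD('i) - 2 \<noteq> 0" 
      using jn card by auto
    ultimately show ?case by simp
  qed
  have poly_eq: "poly p u = (\<Sum>k\<le>n div 2. a (n - 2 * k) * u ^ (n - 2 * k))" for u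
  proof -
    have "poly p u = (\<Sum>j\<le>n. a j * u ^ j)" by (simp add: poly_altdef deg a_def)
    also have "\<dots> = (\<Sum>j\<in>(\<lambda>k. n - 2 * k) ` {..n div 2}. a j * u ^ j)"
    proof (rule sum.mono_neutral_right)
      show "\<forall>j\<in>{..n} - (\<lambda>k. n - 2 * k) ` {..n div 2}. a j * u ^ j = 0"
      proof
        fix j assume j: "j \<in> {..n} - (\<lambda>k. n - 2 * k) ` {..n div 2}"
        have "odd (n - j)"
        proof
          assume "even (n - j)"
          then obtain k where k: "n - j = 2 * k" by (elim evenE)
          with j have "j = n - 2 * k" "k \<le> n div 2" by auto
          with j show False by blast
        qed
        then show "a j * u ^ j = 0" using parity j by simp
      qed
    qed auto
    also have "\<dots> = (\<Sum>k\<le>n div 2. a (n - 2 * k) * u ^ (n - 2 * k))"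
      by (subst sum.reindex) (auto simp: inj_on_def)
    finally show ?thesis .
  qed
  define C where "C = a n * (fact n)\<^sup>2"
  have C: "C > 0" using lead by (simp add: C_def a_def)
  \<comment> \<open>The quadratic form is, up to the positive factor \<open>C\<close>, the Fischer
    square of this combination.\<close>
  define H where "H = (\<lambda>m. \<Sum>r\<in>A. c r * harmonic_zonal n a (x r) m)"
  have "0 \<le> fischer n H H" by (rule fischer_nonneg)
  also have "fischer n H H = (\<Sum>r\<in>A. \<Sum>s\<in>A. c r * c s * fischer n (harmonic_zonal n a (x s)) (harmonic_zonal n a (x r)))"
    unfolding H_def fischer_sum_left fischer_sum_right fischer_scale_left fischer_scale_right
    by (subst sum.swap) (simp add: sum_distrib_left mult_ac)
  also have "\<dots> = (\<Sum>r\<in>A. \<Sum>s\<in>A. C * (c r * poly p (\<Sum>i\<in>UNIV. x r i * x s i) * c s))"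
  proof (intro sum.cong refl)
    fix r s assume "r \<in> A" "s \<in> A"
    then have "fischer n (harmonic_zonal n a (x s)) (harmonic_zonal n a (x r))
       = C * poly p (\<Sum>i\<in>UNIV. x r i * x s i)"
      unfolding poly_eq C_def 
      using fischer_harmonic_zonal[OF x x rec, of s r] by (simp add: a_def mult.commute)
    then show "c r * c s * fischer n (harmonic_zonal n a (x s)) (harmonic_zonal n a (x r))
      = C * (c r * poly p (\<Sum>i\<in>UNIV. x r i * x s i) * c s)" by (simp add: algebra_simps)
  qed
  also have "\<dots> = C * (\<Sum>r\<in>A. \<Sum>s\<in>A. c r * poly p (\<Sum>i\<in>UNIV. x r i * x s i) * c s)"
    by (simp add: sum_distrib_left)
  finally show ?thesis using C by (simp add: zero_le_mult_iff)
qed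

section \<open>Chebyshev and Gegenbauer polynomials\<close>

fun chebyshev :: "nat \<Rightarrow> real poly" where
  "chebyshev 0 = 1"
| "chebyshev (Suc 0) = [:0, 1:]"
| "chebyshev (Suc (Suc n)) = [:0, 2:] * chebyshev (Suc n) - chebyshev n"

lemma poly_chebyshev_cos: "poly (chebyshev n) (cos t) = cos (real n * t)"
proof (induction n rule: chebyshev.induct)
  case (3 n)
  have "cos (real (Suc (Suc n)) * t) + cos (real n * t) = 2 * cos t * cos (real (Suc n) * t)"
    using cos_plus_cos[of "real (Suc (Suc n)) * t" "real n * t"] by (simp add: algebra_simps add_divide_distrib)
  then show ?case by (simp add: 3)
qed auto

lemma degree_chebyshev_le: "degree (chebyshev n) \<le> n"
proof (induction n rule: chebyshev.induct)
  case (3 n)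
  have "degree ([:0, 2:] * chebyshev (Suc n)) \<le> Suc (Suc n)"
    using degree_mult_le[of "[:0, 2:]" "chebyshev (Suc n)"] 3(1) by simp
  then show ?case using 3(2) by (auto intro!: degree_diff_le)
qed auto

lemma coeff_chebyshev: "coeff (chebyshev (Suc n)) (Suc n) = 2 ^ n"
proof (induction n)
  case (Suc n)
  have "coeff (chebyshev n) (Suc (Suc n)) = 0"
    by (rule coeff_eq_0) (use degree_chebyshev_le[of n] in simp)
  then show ?case by (simp add: Suc)
qed simp

text \<open>The values cos t with sin t nonzero fill (-1, 1), an infinite set. Excluding the zeros
  of sin permits division by sin t when identities are checked.\<close>

lemma poly_eqI_cos:
  fixes p q :: "real poly"
  assumes "\<And>t. sin t \<noteq> 0 \<Longrightarrow> poly p (cos t) = poly q (cos t)"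
  shows "p = q"
proof -
  have sub: "{-1<..<1} \<subseteq> {x. poly (p - q) x = 0}"
  proof
    fix x :: real assume x: "x \<in> {-1<..<1}"
    then have "x\<^sup>2 < 1" by (simp add: abs_square_less_1 abs_less_iff)
    then have "sin (arccos x) \<noteq> 0" using x by (simp add: sin_arccos_nonzero)
    then show "x \<in> {x. poly (p - q) x = 0}" using assms[of "arccos x"] x by simp
  qed
  have "infinite {-1<..<1::real}" by simp
  with sub have "infinite {x. poly (p - q) x = 0}" using infinite_super by blast
  then have "p - q = 0" using poly_roots_finite by blast
  then show ?thesis by simp
qed

lemma poly_pderiv_chebyshev_cos:
  "sin t * poly (pderiv (chebyshev n)) (cos t) = real n * sin (real n * t)"
proof -
  have "((\<lambda>t. poly (chebyshev n) (cos t)) has_real_derivative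
          poly (pderiv (chebyshev n)) (cos t) * (- sin t)) (at t)"
    by (rule DERIV_chain2[OF poly_DERIV]) (auto intro!: derivative_eq_intros)
  moreover have "((\<lambda>t. poly (chebyshev n) (cos t)) has_real_derivative - (real n * sin (real n * t))) (at t)"
    unfolding poly_chebyshev_cos by (auto intro!: derivative_eq_intros)
  ultimately show ?thesis using DERIV_unique by fastforce
qed

text \<open>Differentiating both sides of \<open>poly_pderiv_chebyshev_cos\<close> in t gives the
  equation at cos t.\<close>

lemma chebyshev_ode:
  "[:1, 0, -1:] * pderiv (pderiv (chebyshev n)) - [:0, 1:] * pderiv (chebyshev n)
     + smult ((real n)\<^sup>2) (chebyshev n) = 0"
proof (rule poly_eqI_cos)
  fix t :: real assume "sin t \<noteq> 0"
  have "((\<lambda>t. sin t * poly (pderiv (chebyshev n)) (cos t)) has_real_derivative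
      cos t * poly (pderiv (chebyshev n)) (cos t)
      + poly (pderiv (pderiv (chebyshev n))) (cos t) * (- sin t) * sin t) (at t)"
    by (rule DERIV_mult[OF DERIV_sin] DERIV_chain2[OF poly_DERIV] DERIV_cos)+
  moreover have "((\<lambda>t. sin t * poly (pderiv (chebyshev n)) (cos t)) has_real_derivative
      (real n)\<^sup>2 * cos (real n * t)) (at t)"
    unfolding poly_pderiv_chebyshev_cos by (auto intro!: derivative_eq_intros simp: power2_eq_square)
  ultimately have "cos t * poly (pderiv (chebyshev n)) (cos t)
      + poly (pderiv (pderiv (chebyshev n))) (cos t) * (- sin t) * sin t = (real n)\<^sup>2 * cos (real n * t)"
    by (rule DERIV_unique)
  moreover have "1 - cos t * cos t = sin t * sin t"
    using sin_cos_squared_add[of t] by (simp add: power2_eq_square)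
  moreover have "poly [:1, 0, -1:] (cos t) = 1 - cos t * cos t" by simp
  ultimately show "poly ([:1, 0, -1:] * pderiv (pderiv (chebyshev n)) - [:0, 1:] * pderiv (chebyshev n)
     + smult ((real n)\<^sup>2) (chebyshev n)) (cos t) = poly 0 (cos t)"
    by (simp only: poly_add poly_diff poly_mult poly_smult poly_chebyshev_cos) (simp add: algebra_simps)
qed

lemma chebyshev_pderiv_rec:
  "[:1, 0, -1:] * pderiv (chebyshev (Suc n))
     = smult ((real n + 1) / 2) (chebyshev n - chebyshev (Suc (Suc n)))"
proof (rule poly_eqI_cos)
  fix t :: real assume "sin t \<noteq> 0"
  have "poly [:1, 0, -1:] (cos t) = sin t * sin t"
    using sin_cos_squared_add[of t] by (simp add: power2_eq_square)
  then have "poly ([:1, 0, -1:] * pderiv (chebyshev (Suc n))) (cos t)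
      = sin t * (real (Suc n) * sin (real (Suc n) * t))"
    by (simp only: poly_mult mult.assoc poly_pderiv_chebyshev_cos)
  also have "\<dots> = (real n + 1) / 2 * (cos (real n * t) - cos (real (Suc (Suc n)) * t))"
    using cos_diff_cos[of "real n * t" "real (Suc (Suc n)) * t"]
    by (simp add: algebra_simps add_divide_distrib)
  finally show "poly ([:1, 0, -1:] * pderiv (chebyshev (Suc n))) (cos t)
      = poly (smult ((real n + 1) / 2) (chebyshev n - chebyshev (Suc (Suc n)))) (cos t)"
    by (simp only: poly_smult poly_diff poly_chebyshev_cos)
qed

text \<open>In trigonometric form this is the formula for sin((n+3)t) - sin((n+1)t). It drives the
  two-step induction that bounds derivatives.\<close>

lemma pderiv_chebyshev_diff:
  "pderiv (chebyshev (n + 3)) = smult ((real n + 3) / (real n + 1)) (pderiv (chebyshev (n + 1)))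
     + smult (2 * (real n + 3)) (chebyshev (n + 2))"
proof (rule poly_eqI_cos)
  fix t :: real assume t: "sin t \<noteq> 0"
  have c: "poly (pderiv (chebyshev m)) (cos t) = real m * sin (real m * t) / sin t" for m
    using poly_pderiv_chebyshev_cos[of t m] t by (simp add: field_simps)
  have "sin ((real n + 3) * t) - sin ((real n + 1) * t) = 2 * sin t * cos ((real n + 2) * t)"
    using sin_diff_sin[of "(real n + 3) * t" "(real n + 1) * t"]
    by (simp add: algebra_simps add_divide_distrib)
  then have s: "sin ((real n + 3) * t) = sin ((real n + 1) * t) + 2 * sin t * cos ((real n + 2) * t)"
    by simp
  show "poly (pderiv (chebyshev (n + 3))) (cos t)
    = poly (smult ((real n + 3) / (real n + 1)) (pderiv (chebyshev (n + 1)))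
     + smult (2 * (real n + 3)) (chebyshev (n + 2))) (cos t)"
  proof -
    have "(r + 2) * (S + 2 * s * C) / s = (r + 2) / r * (r * S / s) + 2 * (r + 2) * C"
      if "s \<noteq> 0" "r \<noteq> 0" for r s S C :: real
      using that by (simp add: field_simps)
    from this[OF t, of "real n + 1"] show ?thesis
      unfolding poly_add poly_smult c poly_chebyshev_cos of_nat_add of_nat_1 of_nat_numeral s
      by (simp add: add.assoc)
  qed
qed

text \<open>Each differentiation of the Chebyshev equation adds 2 to the factor of x p' and
  subtracts 2l + 1 from the factor of p.\<close>

lemma gegenbauer_ode:
  fixes m l :: nat
  defines "p \<equiv> (pderiv ^^ l) (chebyshev m)"
  shows "[:1, 0, -1:] * pderiv (pderiv p) - smult (2 * real l + 1) ([:0, 1:] * pderiv p)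
     + smult ((real m)\<^sup>2 - (real l)\<^sup>2) p = 0"
  unfolding p_def
proof (induction l)
  case 0
  then show ?case using chebyshev_ode by simp
next
  case (Suc l)
  define q where "q = (pderiv ^^ l) (chebyshev m)"
  have "pderiv ([:1, 0, -1:] * pderiv (pderiv q) - smult (2 * real l + 1) ([:0, 1:] * pderiv q)
     + smult ((real m)\<^sup>2 - (real l)\<^sup>2) q) = 0"
    using Suc by (simp add: q_def)
  moreover have "pderiv [:1, 0, -1:] = [:0, -2::real:]" "pderiv [:0, 1:] = [:1::real:]"
    by (simp_all add: pderiv_pCons)
  ultimately have "poly ([:1, 0, -1:] * pderiv (pderiv (pderiv q)) - smult (2 * real (Suc l) + 1) ([:0, 1:] * pderiv (pderiv q))
     + smult ((real m)\<^sup>2 - (real (Suc l))\<^sup>2) (pderiv q)) x = 0" for x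
    using poly_0 by (simp only: pderiv_add pderiv_diff pderiv_smult pderiv_mult)
      (drule arg_cong[of _ _ "\<lambda>p. poly p x"], simp add: algebra_simps power2_eq_square)
  then show ?case unfolding funpow.simps o_def q_def[symmetric] 
    by (intro poly_eq_poly_eq_iff[THEN iffD1] ext) simp
qed

text \<open>For l >= 1 this is (n + l) 2^(l-1) (l-1)! times the classical Gegenbauer polynomial
  \<open>C_n^(l)\<close>; the index n + l makes the degree n.\<close>

definition gegenbauer :: "nat \<Rightarrow> nat \<Rightarrow> real poly" where
  "gegenbauer l n = (pderiv ^^ l) (chebyshev (n + l))"

text \<open>Comparison of coefficients in \<open>gegenbauer_ode\<close>. It is the harmonicity
  condition for the homogenization in 2l + 2 variables.\<close>

lemma gegenbauer_coeff_rec: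
  "real (j + 2) * real (j + 1) * coeff (gegenbauer l n) (j + 2)
     = (real j - real n) * (real j + real n + 2 * real l) * coeff (gegenbauer l n) j"
proof -
  define p where "p = gegenbauer l n"
  have "pderiv (pderiv p) - pCons 0 (pCons 0 (pderiv (pderiv p))) - smult (2 * real l + 1) (pCons 0 (pderiv p))
     + smult ((real (n + l))\<^sup>2 - (real l)\<^sup>2) p = 0"
  proof -
    have "[:1, 0, -1:] * q = q - pCons 0 (pCons 0 q)" "[:0, 1:] * q = pCons 0 q" for q :: "real poly"
      by (rule poly_eq_poly_eq_iff[THEN iffD1], rule ext, simp add: algebra_simps)+
    then show ?thesis using gegenbauer_ode[of l "n + l"] by (simp only: p_def gegenbauer_def)
  qed
  then have "coeff (pderiv (pderiv p) - pCons 0 (pCons 0 (pderiv (pderiv p))) - smult (2 * real l + 1) (pCons 0 (pderiv p))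
     + smult ((real (n + l))\<^sup>2 - (real l)\<^sup>2) p) j = 0"
    by simp
  moreover have "coeff (pCons 0 (pCons 0 (pderiv (pderiv p)))) j = real j * (real j - 1) * coeff p j"
  proof (cases j)
    case (Suc i)
    then show ?thesis by (cases i) (simp_all add: coeff_pderiv algebra_simps)
  qed simp
  moreover have "coeff (pCons 0 (pderiv p)) j = real j * coeff p j"
    by (cases j) (simp_all add: coeff_pderiv)
  moreover have "coeff (pderiv (pderiv p)) j = real (j + 1) * (real (j + 2) * coeff p (j + 2))"
    by (simp add: coeff_pderiv numeral_2_eq_2)
  ultimately have "real (j + 1) * (real (j + 2) * coeff p (j + 2)) - real j * (real j - 1) * coeff p j
     - (2 * real l + 1) * (real j * coeff p j) + ((real (n + l))\<^sup>2 - (real l)\<^sup>2) * coeff p j = 0"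
    by (simp only: coeff_add coeff_diff coeff_smult)
  then show ?thesis unfolding p_def[symmetric]
    by (simp add: algebra_simps power2_eq_square)
qed

section \<open>Degrees, leading coefficients and bounds of Gegenbauer polynomials\<close>

lemma degree_funpow_pderiv: "degree ((pderiv ^^ l) (p :: real poly)) = degree p - l"
  by (induction l) (simp_all add: degree_pderiv)

lemma degree_chebyshev: "degree (chebyshev n) = n"
proof (cases n)
  case (Suc k)
  then show ?thesis using degree_chebyshev_le[of n] coeff_chebyshev[of k] le_degree[of "chebyshev n" n]
    by simp
qed simp

lemma degree_gegenbauer: "degree (gegenbauer l n) = n"
  by (simp add: gegenbauer_def degree_funpow_pderiv degree_chebyshev)

lemma coeff_funpow_pderiv:
  "coeff ((pderiv ^^ l) (p :: real poly)) n = fact (n + l) / fact n * coeff p (n + l)"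
proof (induction l arbitrary: n)
  case (Suc l)
  have "coeff ((pderiv ^^ Suc l) p) n = real (Suc n) * (fact (Suc n + l) / fact (Suc n) * coeff p (Suc n + l))"
    by (simp only: funpow.simps o_def coeff_pderiv Suc.IH)
  also have "\<dots> = fact (n + Suc l) / fact n * coeff p (n + Suc l)"
    by (simp add: divide_simps del: of_nat_Suc)
  finally show ?case .
qed simp

lemma coeff_gegenbauer: "l \<ge> 1 \<Longrightarrow> coeff (gegenbauer l n) n = fact (n + l) / fact n * 2 ^ (n + l - 1)"
  using coeff_chebyshev[of "n + l - 1"] by (simp add: gegenbauer_def coeff_funpow_pderiv)

lemma abs_chebyshev_le_1:
  assumes "\<bar>x\<bar> \<le> 1" shows "\<bar>poly (chebyshev n) x\<bar> \<le> 1"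
  using poly_chebyshev_cos[of n "arccos x"] assms by (simp add: abs_le_iff)

text \<open>A Markov-type bound, by induction on l and, for fixed l, in steps of two on m through
  \<open>pderiv_chebyshev_diff\<close>. The step closes because r (r - 2) + 2 r = r^2.\<close>

lemma abs_funpow_pderiv_chebyshev_le:
  assumes "\<bar>x\<bar> \<le> 1"
  shows "\<bar>poly ((pderiv ^^ l) (chebyshev m)) x\<bar> \<le> real m ^ (2 * l)"
proof (induction l arbitrary: m)
  case 0
  then show ?case using abs_chebyshev_le_1[OF assms] by simp
next
  case (Suc l)
  note IHl = Suc
  have lin: "(pderiv ^^ k) (smult a p + smult b q) = smult a ((pderiv ^^ k) p) + smult b ((pderiv ^^ k) q)"
    for k a b and p q :: "real poly"
    by (induction k) (simp_all add: pderiv_add pderiv_smult)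
  show ?case
  proof (induction m rule: less_induct)
    case (less m)
    have base: "(pderiv ^^ k) (pderiv 1) = (0::real poly)" for k
      by (induction k) simp_all
    have base1: "(pderiv ^^ k) (pderiv (pderiv [:0,1:])) = (0::real poly)" for k
      by (induction k) (simp_all add: pderiv_pCons)
    \<comment> \<open>The two-step recurrence divides by m - 2, so it starts at m = 3.\<close>
    consider "m = 0" | "m = 1" | "m = 2" | n where "m = n + 3"
      using le_Suc_ex[of 3 m] by (cases "m \<ge> 3") (auto simp: not_le less_Suc_eq numeral_3_eq_3)
    then show ?case
    proof cases
      case 1
      then show ?thesis by (simp add: funpow_Suc_right base del: funpow.simps)
    next
      case 2
      then show ?thesis
      proof (cases l)
        case 0 then show ?thesis using 2 by (simp add: pderiv_pCons)
      next
        case (Suc k)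
        then show ?thesis using 2 by (simp add: funpow_Suc_right base1 del: funpow.simps)
      qed
    next
      case 3
      have "chebyshev 2 = smult 2 ([:0,1:] * [:0,1:]) - 1" by (simp add: numeral_2_eq_2)
      then have "pderiv (chebyshev 2) = smult 4 (chebyshev 1) + smult 0 1"
        by (simp add: pderiv_pCons pderiv_diff pderiv_smult pderiv_mult one_pCons)
      then have "(pderiv ^^ Suc l) (chebyshev 2) = smult 4 ((pderiv ^^ l) (chebyshev 1))"
        unfolding funpow_Suc_right o_def by (simp only: lin) simp
      then have "\<bar>poly ((pderiv ^^ Suc l) (chebyshev 2)) x\<bar> \<le> 4 * 1"
        using IHl[of 1] by (simp add: abs_mult del: funpow.simps)
      also have "4 * 1 \<le> real 2 ^ (2 * Suc l)"
        using one_le_power[of "4::real" l] by (simp add: power_mult)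
      finally show ?thesis using 3 by simp
    next
      case (4 n)
      define r where "r = real n + 3"
      have r: "r \<ge> 3" by (simp add: r_def)
      have "\<bar>poly ((pderiv ^^ Suc l) (chebyshev m)) x\<bar>
          = \<bar>r / (r - 2) * poly ((pderiv ^^ Suc l) (chebyshev (n + 1))) x + 2 * r * poly ((pderiv ^^ l) (chebyshev (n + 2))) x\<bar>"
      proof -
        have "real n + 3 = r" "real n + 1 = r - 2" by (simp_all add: r_def)
        then show ?thesis
          unfolding funpow_Suc_right o_def 4 pderiv_chebyshev_diff lin by (simp only: poly_add poly_smult)
      qed
      also have "\<dots> \<le> r / (r - 2) * \<bar>poly ((pderiv ^^ Suc l) (chebyshev (n + 1))) x\<bar>
          + 2 * r * \<bar>poly ((pderiv ^^ l) (chebyshev (n + 2))) x\<bar>"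
        using r by (intro order_trans[OF abs_triangle_ineq]) (simp add: abs_mult)
      also have "\<dots> \<le> r / (r - 2) * (r - 2) ^ (2 * Suc l) + 2 * r * r ^ (2 * l)"
      proof (intro add_mono mult_left_mono)
        show "\<bar>poly ((pderiv ^^ Suc l) (chebyshev (n + 1))) x\<bar> \<le> (r - 2) ^ (2 * Suc l)"
          using less[of "n + 1"] 4 by (simp add: r_def add.commute)
        have "\<bar>poly ((pderiv ^^ l) (chebyshev (n + 2))) x\<bar> \<le> real (n + 2) ^ (2 * l)" by (rule IHl)
        also have "\<dots> \<le> r ^ (2 * l)" by (intro power_mono) (simp_all add: r_def)
        finally show "\<bar>poly ((pderiv ^^ l) (chebyshev (n + 2))) x\<bar> \<le> r ^ (2 * l)" .
      qed (use r in auto)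
      also have "r / (r - 2) * (r - 2) ^ (2 * Suc l) = r * (r - 2) * (r - 2) ^ (2 * l)"
        using r by (simp add: field_simps)
      also have "\<dots> \<le> r * (r - 2) * r ^ (2 * l)"
        using r by (intro mult_left_mono power_mono) auto
      also have "r * (r - 2) * r ^ (2 * l) + 2 * r * r ^ (2 * l) = r ^ (2 * Suc l)"
        by (simp add: algebra_simps)
      finally show ?thesis using 4 by (simp add: r_def)
    qed
  qed
qed

lemma abs_gegenbauer_le: "\<bar>x\<bar> \<le> 1 \<Longrightarrow> \<bar>poly (gegenbauer l n) x\<bar> \<le> real (n + l) ^ (2 * l)"
  unfolding gegenbauer_def by (rule abs_funpow_pderiv_chebyshev_le)

text \<open>The algebraic core of \<open>weighted_gegenbauer_eq\<close>: there 1 - x^2 becomes sin^2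
  t, and the right-hand terms are the neighbours whose difference defines the next weighted
  function.\<close>

lemma funpow_pderiv_chebyshev_rec:
  fixes k l :: nat
  defines "m \<equiv> real k + 2"
  shows "[:1, 0, -1:] * (pderiv ^^ Suc l) (chebyshev (k + 2))
    = smult ((m - 1 + real l) * (m + real l) / (2 * (m - 1))) ((pderiv ^^ l) (chebyshev (k + 1)))
      - smult ((m - real l) * (m + 1 - real l) / (2 * (m + 1))) ((pderiv ^^ l) (chebyshev (k + 3)))"
proof (induction l)
  case 0
  have "m - 1 \<noteq> 0" "m + 1 \<noteq> 0" by (simp_all add: m_def)
  then have "(m - 1 + real 0) * (m + real 0) / (2 * (m - 1)) = m / 2"
    "(m - real 0) * (m + 1 - real 0) / (2 * (m + 1)) = m / 2"
    by (simp_all add: field_simps)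
  moreover have "Suc (k + 1) = k + 2" "Suc (Suc (k + 1)) = k + 3" "real (k + 1) + 1 = m"
    by (simp_all add: m_def)
  ultimately show ?case using chebyshev_pderiv_rec[of "k + 1"]
    by (simp only: funpow.simps o_def id_apply smult_diff_right)
next
  case (Suc l)
  define P where "P = (pderiv ^^ Suc l) (chebyshev (k + 2))"
  define Q where "Q = (pderiv ^^ l) (chebyshev (k + 2))"
  define U where "U = (pderiv ^^ Suc l) (chebyshev (k + 1))"
  define W where "W = (pderiv ^^ Suc l) (chebyshev (k + 3))"
  define a where "a = (m - 1 + real l) * (m + real l) / (2 * (m - 1))"
  define b where "b = (m - real l) * (m + 1 - real l) / (2 * (m + 1))"
  have m: "m - 1 \<noteq> 0" "m + 1 \<noteq> 0" by (simp_all add: m_def)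
  have lin: "(pderiv ^^ j) (smult a p + smult b q) = smult a ((pderiv ^^ j) p) + smult b ((pderiv ^^ j) q)"
    for j a b and p q :: "real poly"
    by (induction j) (simp_all add: pderiv_add pderiv_smult)
  have 0: "pderiv ([:1, 0, -1:] * P) = pderiv (smult a ((pderiv ^^ l) (chebyshev (k + 1))) - smult b ((pderiv ^^ l) (chebyshev (k + 3))))"
    unfolding P_def a_def b_def by (simp only: Suc)
  have e1: "[:1, 0, -1:] * pderiv P + P * [:0, -2:] = smult a U - smult b W"
  proof -
    have "pderiv [:1, 0, -1:] = [:0, -2::real:]" by (simp add: pderiv_pCons)
    then show ?thesis using 0 
      by (simp only: pderiv_mult pderiv_diff pderiv_smult U_def W_def funpow.simps o_def)
  qed
  have "(pderiv ^^ Suc l) (chebyshev (k + 3)) = smult ((m + 1) / (m - 1)) U + smult (2 * (m + 1)) Q"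
    unfolding funpow_Suc_right o_def pderiv_chebyshev_diff lin U_def Q_def m_def by (simp add: add.commute)
  then have e2: "W = smult ((m + 1) / (m - 1)) U + smult (2 * (m + 1)) Q" by (simp add: W_def)
  have leib: "(pderiv ^^ Suc j) ([:0, 2:] * p) = [:0, 2:] * (pderiv ^^ Suc j) p + smult (2 * (real j + 1)) ((pderiv ^^ j) p)"
    for j and p :: "real poly"
  proof (induction j)
    case 0
    then show ?case by (simp add: pderiv_mult pderiv_pCons pderiv_smult)
  next
    case (Suc j)
    have "(pderiv ^^ Suc (Suc j)) ([:0, 2:] * p) = pderiv ((pderiv ^^ Suc j) ([:0, 2:] * p))" by simp
    also have "\<dots> = [:0, 2:] * (pderiv ^^ Suc (Suc j)) p + smult (2 * (real (Suc j) + 1)) ((pderiv ^^ Suc j) p)"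
      unfolding Suc by (simp add: pderiv_mult pderiv_add pderiv_smult pderiv_pCons algebra_simps smult_add_left flip: smult_add_left)
    finally show ?case .
  qed
  \<comment> \<open>Differentiating the three-term recurrence l + 1 times expresses x P through U, W
    and Q; \<open>e2\<close> expresses Q through U and W. Together they eliminate x P from
    \<open>e1\<close>.\<close>
  have c3: "[:0, 2:] * chebyshev (k + 2) = smult 1 (chebyshev (k + 3)) + smult 1 (chebyshev (k + 1))"
    by (simp add: eval_nat_numeral)
  have e3: "[:0, 2:] * P + smult (2 * (real l + 1)) Q = W + U"
    using leib[of l "chebyshev (k + 2)"] unfolding c3 lin P_def Q_def W_def U_def by simp
  have "poly ([:1, 0, -1:] * pderiv P) x
     = ((m - 1 + real (Suc l)) * (m + real (Suc l)) / (2 * (m - 1))) * poly U x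
      - ((m - real (Suc l)) * (m + 1 - real (Suc l)) / (2 * (m + 1))) * poly W x" for x
  proof -
    define z u w q where "z = poly P x" and "u = poly U x" and "w = poly W x" and "q = poly Q x"
    have 1: "poly ([:1, 0, -1:] * pderiv P) x = a * u - b * w + 2 * x * z"
      using arg_cong[OF e1, of "\<lambda>p. poly p x"] by (simp add: z_def u_def w_def algebra_simps)
    have 2: "w = (m + 1) / (m - 1) * u + 2 * (m + 1) * q"
      using arg_cong[OF e2, of "\<lambda>p. poly p x"] by (simp add: u_def w_def q_def)
    have 3: "2 * x * z = w + u - 2 * (real l + 1) * q"
      using arg_cong[OF e3, of "\<lambda>p. poly p x"] by (simp add: z_def u_def w_def q_def algebra_simps)
    have 4: "q = (w / (m + 1) - u / (m - 1)) / 2"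
    proof -
      have "w / (m + 1) = u / (m - 1) + 2 * q"
      proof -
        have "(a / c * u + 2 * a * q) / a = u / c + 2 * q" if "a \<noteq> 0" for a c :: real
          using that by (simp add: add_divide_distrib)
        from this[OF m(2)] show ?thesis unfolding 2 .
      qed
      then show ?thesis by simp
    qed
    show ?thesis unfolding 1 3 4 a_def b_def u_def[symmetric] w_def[symmetric]
      using m by (simp add: divide_simps) (simp add: algebra_simps)
  qed
  then show ?case unfolding U_def[symmetric] W_def[symmetric] a_def b_def
    by (intro poly_eq_poly_eq_iff[THEN iffD1] ext) (simp add: P_def)
qed


text \<open>The recursion for divided differences, with alternating sign; the divisor is (n + 2l +
  2)^2 - n^2, the difference of the extreme nodes.\<close>

primrec weighted_gegenbauer :: "nat \<Rightarrow> nat \<Rightarrow> real \<Rightarrow> real" where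
  "weighted_gegenbauer 0 n t = cos (real n * t)"
| "weighted_gegenbauer (Suc l) n t = (weighted_gegenbauer l n t - weighted_gegenbauer l (n + 2) t) / (4 * (real l + 1) * (real n + real l + 1))"

text \<open>By \<open>funpow_pderiv_chebyshev_rec\<close>, a factor sin^2 t turns the polynomial of
  the next order into a combination of two neighbours. The power of sin is the Gegenbauer weight
  after the substitution x = cos t.\<close>

lemma weighted_gegenbauer_eq:
  "weighted_gegenbauer (Suc l) n t = fact n / ((real n + real l + 1) * fact (n + 2 * l + 1) * 2 ^ Suc l * fact (Suc l))
     * sin t ^ (2 * Suc l) * poly (gegenbauer (Suc l) n) (cos t)"
proof (induction l arbitrary: n)
  case 0
  have "sin t ^ 2 = poly [:1, 0, -1:] (cos t)"
    using sin_cos_squared_add[of t] by (simp add: power2_eq_square)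
  then have "sin t ^ 2 * poly (gegenbauer 1 n) (cos t) = poly ([:1, 0, -1:] * pderiv (chebyshev (Suc n))) (cos t)"
    by (simp only: poly_mult gegenbauer_def) simp
  also have "\<dots> = (real n + 1) / 2 * (cos (real n * t) - cos (real (n + 2) * t))"
    unfolding chebyshev_pderiv_rec by (simp only: poly_smult poly_diff poly_chebyshev_cos) simp
  finally have e: "sin t ^ 2 * poly (gegenbauer 1 n) (cos t) = (real n + 1) / 2 * (cos (real n * t) - cos (real (n + 2) * t))" .
  have "fact n / ((real n + 1) * fact (n + 1) * 2) * ((real n + 1) / 2 * X) = X / (4 * (real n + 1))" for X
    by (simp add: divide_simps)
  from this[of "cos (real n * t) - cos (real (n + 2) * t)"] show ?case
    unfolding e[symmetric] by (simp add: mult_ac)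
next
  case (Suc l)
  define N L where "N = real n" and "L = real l"
  have NL: "N \<ge> 0" "L \<ge> 0" by (simp_all add: N_def L_def)
  define C where "C = sin t ^ (2 * Suc l)"
  define U where "U = poly (gegenbauer (Suc l) n) (cos t)"
  define W where "W = poly (gegenbauer (Suc l) (n + 2)) (cos t)"
  define F G where "F = (fact n :: real)" and "G = (fact (n + 2 * l + 1) :: real)"
  define H where "H = (2 ^ Suc l * fact (Suc l) :: real)"
  have pos: "F > 0" "G > 0" "H > 0" by (simp_all add: F_def G_def H_def)
  define X where "X = sin t ^ 2 * poly (gegenbauer (Suc (Suc l)) n) (cos t)"
  have "sin t ^ 2 = poly [:1, 0, -1:] (cos t)" "n + Suc (Suc l) = n + l + 2"
    using sin_cos_squared_add[of t] by (simp_all add: power2_eq_square)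
  then have "X = poly ([:1, 0, -1:] * (pderiv ^^ Suc (Suc l)) (chebyshev ((n + l) + 2))) (cos t)"
    by (simp only: X_def gegenbauer_def poly_mult)
  also have "\<dots> = ((N + 2 * L + 2) * (N + 2 * L + 3) / (2 * (N + L + 1))) * U
      - (N + 1) * (N + 2) / (2 * (N + L + 3)) * W"
  proof -
    have "chebyshev (n + l + 1) = chebyshev (n + Suc l)" "chebyshev (n + l + 3) = chebyshev (n + 2 + Suc l)"
      by (rule arg_cong[of _ _ chebyshev], simp)+
    then show ?thesis
      unfolding funpow_pderiv_chebyshev_rec
      by (simp add: U_def W_def gegenbauer_def N_def L_def algebra_simps del: funpow.simps chebyshev.simps)
  qed
  finally have X: "X = ((N + 2 * L + 2) * (N + 2 * L + 3) / (2 * (N + L + 1))) * U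
      - (N + 1) * (N + 2) / (2 * (N + L + 3)) * W" .
  have f1: "fact (n + 2) = (N + 1) * (N + 2) * F"
    by (simp add: F_def N_def algebra_simps)
  have f2: "fact (n + 2 + 2 * l + 1) = (N + 2 * L + 2) * (N + 2 * L + 3) * G"
    by (simp add: G_def N_def L_def algebra_simps)
  have f3: "2 ^ Suc (Suc l) * fact (Suc (Suc l)) = 2 * (L + 2) * H"
    by (simp add: H_def L_def algebra_simps)
  have "weighted_gegenbauer (Suc (Suc l)) n t = (F / ((N + L + 1) * G * H) * C * U
      - (N + 1) * (N + 2) * F / ((N + L + 3) * ((N + 2 * L + 2) * (N + 2 * L + 3) * G) * H) * C * W)
      / (4 * (L + 2) * (N + L + 2))"
    unfolding weighted_gegenbauer.simps(2)[of "Suc l"] Suc f1 f2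
    by (simp add: U_def W_def C_def F_def G_def H_def N_def L_def add_ac mult_ac)
  also have "\<dots> = F / ((N + L + 2) * ((N + 2 * L + 2) * (N + 2 * L + 3) * G) * (2 * (L + 2) * H)) * C * X"
  proof -
    define a b c p q where "a = N + L + 1" and "b = N + L + 3" and "c = (N + 2 * L + 2) * (N + 2 * L + 3)"
      and "p = L + 2" and "q = N + L + 2"
    have nz: "a > 0" "b > 0" "c > 0" "p > 0" "q > 0"
      using NL by (auto simp: a_def b_def c_def p_def q_def)
    have "(F / (a * G * H) * C * U - m * F / (b * (c * G) * H) * C * W) / (4 * p * q)
      = F / (q * (c * G) * (2 * p * H)) * C * (c / (2 * a) * U - m / (2 * b) * W)" for m
      using nz pos by (simp add: field_simps)
    then show ?thesis unfolding X a_def b_def c_def p_def q_def by simp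
  qed
  also have "\<dots> = fact n / ((real n + real (Suc l) + 1) * fact (n + 2 * Suc l + 1) * 2 ^ Suc (Suc l) * fact (Suc (Suc l)))
     * sin t ^ (2 * Suc (Suc l)) * poly (gegenbauer (Suc (Suc l)) n) (cos t)"
  proof -
    have "sin t ^ (2 * Suc (Suc l)) = C * sin t ^ 2"
      by (simp add: C_def power_add[symmetric])
    moreover have "n + 2 * Suc l + 1 = n + 2 + 2 * l + 1" by simp
    moreover have "real n + real (Suc l) + 1 = N + L + 2" by (simp add: N_def L_def)
    ultimately show ?thesis
      by (simp only: f2 mult.assoc f3[unfolded mult.assoc] X_def F_def)
  qed
  finally show ?case .
qed

lemma continuous_on_weighted_gegenbauer [continuous_intros]: "continuous_on S (weighted_gegenbauer l n)"
  by (induction l arbitrary: n) (auto intro!: continuous_intros simp: add_pos_nonneg[THEN less_imp_neq, symmetric])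

section \<open>Orthogonality relations\<close>

lemma has_integral_cos_multiple:
  "((\<lambda>t. cos (real n * t)) has_integral (if n = 0 then pi else 0)) {0..pi}"
proof (cases "n = 0")
  case True
  then show ?thesis using has_integral_const_real[of "1::real" 0 pi] by simp
next
  case False
  have "((\<lambda>t. cos (real n * t)) has_integral (sin (real n * pi) / real n - sin (real n * 0) / real n)) {0..pi}"
    by (rule fundamental_theorem_of_calculus)
       (use False in \<open>auto intro!: derivative_eq_intros simp: has_real_derivative_iff_has_vector_derivative[symmetric]\<close>)
  then show ?thesis using False by simp
qed

text \<open>A factor cos t splits the frequency n into n + 1 and n - 1, each with weight 1/2. The
  higher one exceeds the degree of the remaining polynomial and contributes 0, so only the leading
  coefficient is seen.\<close>

lemma has_integral_poly_cos:
  assumes "degree p \<le> n"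
  shows "((\<lambda>t. poly p (cos t) * cos (real n * t)) has_integral coeff p n * pi / 2 ^ n) {0..pi}"
  using assms
proof (induction p arbitrary: n rule: pCons_induct)
  case 0
  then show ?case by simp
next
  case (pCons a q)
  have c: "((\<lambda>t. a * cos (real n * t)) has_integral a * (if n = 0 then pi else 0)) {0..pi}"
    by (rule has_integral_mult_right[OF has_integral_cos_multiple])
  show ?case
  proof (cases "q = 0")
    case True
    then show ?thesis using c by (cases n) auto
  next
    case False
    with pCons.prems obtain k where k: "n = Suc k" "degree q \<le> k" by (cases n) auto
    have "((\<lambda>t. 1/2 * (poly q (cos t) * cos (real (k + 2) * t) + poly q (cos t) * cos (real k * t)))
      has_integral 1/2 * (coeff q (k + 2) * pi / 2 ^ (k + 2) + coeff q k * pi / 2 ^ k)) {0..pi}"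
      using k by (intro has_integral_mult_right has_integral_add pCons.IH) auto
    also have "coeff q (k + 2) = 0" using k by (intro coeff_eq_0) auto
    also have "(\<lambda>t. 1/2 * (poly q (cos t) * cos (real (k + 2) * t) + poly q (cos t) * cos (real k * t)))
       = (\<lambda>t. cos t * poly q (cos t) * cos (real n * t))"
    proof
      fix t
      have "cos (real (k + 2) * t) + cos (real k * t) = 2 * cos t * cos (real n * t)"
        using cos_plus_cos[of "real (k + 2) * t" "real k * t"] k(1)
        by (simp add: algebra_simps add_divide_distrib)
      then have "1/2 * poly q (cos t) * (cos (real (k + 2) * t) + cos (real k * t))
          = cos t * poly q (cos t) * cos (real n * t)" by simp
      then show "1/2 * (poly q (cos t) * cos (real (k + 2) * t) + poly q (cos t) * cos (real k * t))
         = cos t * poly q (cos t) * cos (real n * t)" by (simp only: distrib_left mult.assoc)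
    qed
    finally have "((\<lambda>t. a * cos (real n * t) + cos t * poly q (cos t) * cos (real n * t)) has_integral
       a * (if n = 0 then pi else 0) + 1/2 * (0 * pi / 2 ^ (k + 2) + coeff q k * pi / 2 ^ k)) {0..pi}"
      by (intro has_integral_add c)
    then show ?thesis using k by (simp add: algebra_simps)
  qed
qed

text \<open>In the difference defining the next weighted function the term with index n + 2 pairs to
  0 by degree; the other one collects a divisor at every step.\<close>

lemma has_integral_poly_weighted_gegenbauer:
  assumes "degree p \<le> n"
  shows "((\<lambda>t. poly p (cos t) * weighted_gegenbauer l n t) has_integral
    coeff p n * pi / 2 ^ n * (\<Prod>j=1..l. 1 / (4 * real j * (real n + real j)))) {0..pi}"
  using assms
proof (induction l arbitrary: n)
  case 0
  then show ?case using has_integral_poly_cos by simp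
next
  case (Suc l)
  have z: "coeff p (n + 2) = 0" using Suc.prems by (intro coeff_eq_0) auto
  define P where "P = (\<Prod>j=1..l. 1 / (4 * real j * (real n + real j)))"
  have "((\<lambda>t. (poly p (cos t) * weighted_gegenbauer l n t - poly p (cos t) * weighted_gegenbauer l (n + 2) t)
        * (1 / (4 * (real l + 1) * (real n + real l + 1)))) has_integral
      (coeff p n * pi / 2 ^ n * P - coeff p (n + 2) * pi / 2 ^ (n + 2)
         * (\<Prod>j=1..l. 1 / (4 * real j * (real (n + 2) + real j))))
        * (1 / (4 * (real l + 1) * (real n + real l + 1)))) {0..pi}"
    unfolding P_def
    by (intro has_integral_mult_left has_integral_diff Suc.IH) (use Suc.prems in auto)
  moreover have "(\<Prod>j=1..Suc l. 1 / (4 * real j * (real n + real j)))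
      = P * (1 / (4 * (real l + 1) * (real n + real l + 1)))"
    by (simp add: P_def add_ac)
  moreover have "(\<lambda>t. poly p (cos t) * weighted_gegenbauer (Suc l) n t) = (\<lambda>t. (poly p (cos t) * weighted_gegenbauer l n t
      - poly p (cos t) * weighted_gegenbauer l (n + 2) t) * (1 / (4 * (real l + 1) * (real n + real l + 1))))"
    by (simp add: right_diff_distrib)
  ultimately show ?case by (simp only: z mult_zero_left div_0 diff_0_right mult.assoc)
qed

text \<open>The leading coefficient cancels the dependence of the divisors on n, so one constant
  normalises all coefficients in \<open>fourier_coef\<close>.\<close>

lemma has_integral_gegenbauer_norm:
  assumes "l \<ge> 1"
  shows "((\<lambda>t. poly (gegenbauer l n) (cos t) * weighted_gegenbauer l n t) has_integral 2 ^ (l - 1) * pi / (4 ^ l * fact l)) {0..pi}"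
proof -
  have 1: "fact (n + l) / fact n * (\<Prod>j=1..l. 1 / (4 * real j * (real n + real j))) = 1 / (4 ^ l * fact l)"
  proof (induction l)
    case (Suc l)
    have "fact (n + Suc l) / fact n * (\<Prod>j=1..Suc l. 1 / (4 * real j * (real n + real j)))
      = (fact (n + l) / fact n * (\<Prod>j=1..l. 1 / (4 * real j * (real n + real j))))
        * ((real n + real (Suc l)) * (1 / (4 * real (Suc l) * (real n + real (Suc l)))))"
      by (simp add: algebra_simps)
    also have "\<dots> = 1 / (4 ^ l * fact l) * (1 / (4 * real (Suc l)))"
    proof -
      have "X * (1 / (4 * Y * X)) = 1 / (4 * Y)" if "X \<noteq> 0" for X Y :: real
        using that by simp
      from this[of "real n + real (Suc l)" "real (Suc l)"] show ?thesis unfolding Suc by simp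
    qed
    finally show ?case by (simp add: mult_ac)
  qed simp
  have 2: "(2::real) ^ (n + l - 1) = 2 ^ n * 2 ^ (l - 1)"
    using assms by (simp add: power_add[symmetric])
  have e: "coeff (gegenbauer l n) n * pi / 2 ^ n * (\<Prod>j=1..l. 1 / (4 * real j * (real n + real j)))
    = 2 ^ (l - 1) * pi / (4 ^ l * fact l)"
  proof -
    have "F * (2 ^ n * c) * pi / 2 ^ n * R = c * pi * (F * R)" for F R c :: real
      by simp
    then show ?thesis unfolding coeff_gegenbauer[OF assms] 2 by (simp only: 1) simp
  qed
  show ?thesis using has_integral_poly_weighted_gegenbauer[of "gegenbauer l n" n l] degree_gegenbauer[of l n] unfolding e by simp
qed

lemma has_integral_gegenbauer_orthogonal:
  assumes "l \<ge> 1" "m \<noteq> n"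
  shows "((\<lambda>t. poly (gegenbauer l m) (cos t) * weighted_gegenbauer l n t) has_integral 0) {0..pi}"
proof -
  have less: "((\<lambda>t. poly (gegenbauer l i) (cos t) * weighted_gegenbauer l j t) has_integral 0) {0..pi}" if "i < j" for i j
    using has_integral_poly_weighted_gegenbauer[of "gegenbauer l i" j l] that degree_gegenbauer[of l i] coeff_eq_0[of "gegenbauer l i" j] by simp
  show ?thesis
  proof (cases "m < n")
    case False
    then have "n < m" using assms by simp
    obtain k where k: "l = Suc k" using assms by (cases l) auto
    \<comment> \<open>By \<open>weighted_gegenbauer_eq\<close> the integrand is symmetric in m and n
      up to the factor \<open>c n / c m\<close>, which reduces this case to the degree
      argument.\<close>
    define c where "c i = (fact i / ((real i + real k + 1) * fact (i + 2 * k + 1) * 2 ^ Suc k * fact (Suc k)) :: real)" for i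
    have c: "c i > 0" for i unfolding c_def by (intro divide_pos_pos mult_pos_pos) auto
    have "((\<lambda>t. c n / c m * (poly (gegenbauer l n) (cos t) * weighted_gegenbauer l m t)) has_integral c n / c m * 0) {0..pi}"
      by (intro has_integral_mult_right less \<open>n < m\<close>)
    moreover have "c n / c m * (poly (gegenbauer l n) (cos t) * weighted_gegenbauer l m t) = poly (gegenbauer l m) (cos t) * weighted_gegenbauer l n t" for t
      unfolding k weighted_gegenbauer_eq c_def[symmetric] using c[of m] by simp
    ultimately show ?thesis by simp
  qed (rule less)
qed

section \<open>Positivity of the iterated integrals\<close>

primrec iter_int :: "nat \<Rightarrow> (real \<Rightarrow> real) \<Rightarrow> real \<Rightarrow> real" where
  "iter_int 0 f = f"
| "iter_int (Suc k) f = (\<lambda>t. integral {0..t} (iter_int k f))"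

section \<open>Iterated antiderivatives\<close>

lemma continuous_on_iter_int:
  assumes "continuous_on {0..b} f"
  shows "continuous_on {0..b} (iter_int k f)"
proof (induction k)
  case (Suc k)
  then have "(iter_int k f) integrable_on {0..b}"
    by (rule integrable_continuous_real)
  then show ?case
    by (simp add: indefinite_integral_continuous_1)
qed (simp add: assms)

lemma iter_int_has_real_derivative:
  assumes "continuous_on {0..b} f" "t \<in> {0..b}"
  shows "(iter_int (Suc k) f has_real_derivative iter_int k f t) (at t within {0..b})"
  using integral_has_real_derivative[OF continuous_on_iter_int[OF assms(1)] assms(2)] by simp

lemma integrable_iter_int:
  assumes "continuous_on {0..b} f" "t \<in> {0..b}"
  shows "iter_int k f integrable_on {0..t}"
  by (rule integrable_continuous_real, rule continuous_on_subset[OF continuous_on_iter_int[OF assms(1)]])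
     (use assms in auto)

lemma iter_int_add_mult:
  assumes "continuous_on {0..b} f" "continuous_on {0..b} g"
  shows "t \<in> {0..b} \<Longrightarrow> iter_int k (\<lambda>x. c * f x + d * g x) t = c * iter_int k f t + d * iter_int k g t"
proof (induction k arbitrary: t)
  case (Suc k)
  have "iter_int (Suc k) (\<lambda>x. c * f x + d * g x) t = integral {0..t} (\<lambda>x. c * iter_int k f x + d * iter_int k g x)"
    unfolding iter_int.simps by (rule integral_cong) (use Suc in auto)
  also have "\<dots> = c * iter_int (Suc k) f t + d * iter_int (Suc k) g t"
    using Suc.prems assms
    by (simp add: integral_add integrable_iter_int integrable_on_mult_right)
  finally show ?case .
qed simp

lemma iter_int_add_index: "iter_int (j + k) f = iter_int j (iter_int k f)"
  by (induction j) auto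

lemma iter_int_cong:
  assumes "\<And>x. x \<in> {0..b} \<Longrightarrow> f x = g x"
  shows "t \<in> {0..b} \<Longrightarrow> iter_int k f t = iter_int k g t"
proof (induction k arbitrary: t)
  case (Suc k)
  then show ?case by (auto intro!: integral_cong)
qed (simp add: assms)

text \<open>The twice integrated form of y'' = - m^2 y for the cosine; without division by m^2 it
  covers m = 0 as well.\<close>

lemma iter_int_2_cos:
  assumes "t \<ge> 0"
  shows "cos (m * t) + m\<^sup>2 * iter_int 2 (\<lambda>x. cos (m * x)) t = 1"
proof (cases "m = 0")
  case False
  have 1: "iter_int 1 (\<lambda>x. cos (m * x)) s = sin (m * s) / m" if "s \<ge> 0" for s
  proof -
    have "((\<lambda>x. cos (m * x)) has_integral (sin (m * s) / m - sin (m * 0) / m)) {0..s}"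
      using that False by (intro fundamental_theorem_of_calculus)
        (auto intro!: derivative_eq_intros simp: has_real_derivative_iff_has_vector_derivative[symmetric])
    then show ?thesis by (simp add: integral_unique)
  qed
  have "iter_int 2 (\<lambda>x. cos (m * x)) t = integral {0..t} (iter_int 1 (\<lambda>x. cos (m * x)))"
    by (simp add: numeral_2_eq_2)
  also have "\<dots> = integral {0..t} (\<lambda>s. sin (m * s) / m)"
    by (rule integral_cong) (use 1 in auto)
  also have "integral {0..t} (\<lambda>s. sin (m * s) / m) = (1 - cos (m * t)) / m\<^sup>2"
  proof -
    have I: "((\<lambda>s. sin (m * s) / m) has_integral (- cos (m * t) / m\<^sup>2 - - cos (m * 0) / m\<^sup>2)) {0..t}"
      using assms False by (intro fundamental_theorem_of_calculus)
        (auto intro!: derivative_eq_intros simp: has_real_derivative_iff_has_vector_derivative[symmetric] power2_eq_square)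
    show ?thesis
      using integral_unique[OF I] by (simp add: diff_divide_distrib)
  qed
  finally show ?thesis using False by simp
qed simp

lemma iter_int_weighted_gegenbauer_Suc:
  assumes "t \<ge> 0"
  shows "iter_int k (weighted_gegenbauer (Suc l) n) t
    = (iter_int k (weighted_gegenbauer l n) t - iter_int k (weighted_gegenbauer l (n + 2)) t) / (4 * (real l + 1) * (real n + real l + 1))"
proof -
  let ?c = "4 * (real l + 1) * (real n + real l + 1)"
  have "weighted_gegenbauer (Suc l) n = (\<lambda>x. 1 / ?c * weighted_gegenbauer l n x + (- 1 / ?c) * weighted_gegenbauer l (n + 2) x)"
    by (rule ext) (simp add: diff_divide_distrib)
  then have "iter_int k (weighted_gegenbauer (Suc l) n) t
     = 1 / ?c * iter_int k (weighted_gegenbauer l n) t + (- 1 / ?c) * iter_int k (weighted_gegenbauer l (n + 2)) t"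
    using iter_int_add_mult[of t "weighted_gegenbauer l n" "weighted_gegenbauer l (n + 2)" t k "1 / ?c" "- 1 / ?c"] assms
      continuous_on_weighted_gegenbauer by simp
  then show ?thesis by (simp add: diff_divide_distrib)
qed

text \<open>The integrated forms of \<open>v'' + (n + 2 l + 2)\<^sup>2 v = weighted_gegenbauer l n\<close> and
  \<open>v'' + n\<^sup>2 v = weighted_gegenbauer l (n + 2)\<close>
  for \<open>v = weighted_gegenbauer (Suc l) n\<close>, proved simultaneously since each induction step needs both.\<close>

lemma weighted_gegenbauer_ode:
  assumes "t \<ge> 0"
  shows "weighted_gegenbauer (Suc l) n t + (real n + 2 * real l + 2)\<^sup>2 * iter_int 2 (weighted_gegenbauer (Suc l) n) t = iter_int 2 (weighted_gegenbauer l n) t"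
    and "weighted_gegenbauer (Suc l) n t + (real n)\<^sup>2 * iter_int 2 (weighted_gegenbauer (Suc l) n) t = iter_int 2 (weighted_gegenbauer l (n + 2)) t"
proof -
  have "weighted_gegenbauer (Suc l) n t + (real n + 2 * real l + 2)\<^sup>2 * iter_int 2 (weighted_gegenbauer (Suc l) n) t = iter_int 2 (weighted_gegenbauer l n) t
    \<and> weighted_gegenbauer (Suc l) n t + (real n)\<^sup>2 * iter_int 2 (weighted_gegenbauer (Suc l) n) t = iter_int 2 (weighted_gegenbauer l (n + 2)) t"
  proof (induction l arbitrary: n)
    case 0
    define a b x y where "a = weighted_gegenbauer 0 n t" and "b = weighted_gegenbauer 0 (n + 2) t"
      and "x = iter_int 2 (weighted_gegenbauer 0 n) t" and "y = iter_int 2 (weighted_gegenbauer 0 (n + 2)) t"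
    define N where "N = real n"
    have g: "weighted_gegenbauer 0 m = (\<lambda>x. cos (real m * x))" for m by (rule ext) simp
    have ab: "a = 1 - N\<^sup>2 * x" "b = 1 - (N + 2)\<^sup>2 * y"
      using iter_int_2_cos[OF assms, of "real n"] iter_int_2_cos[OF assms, of "real (n + 2)"]
      by (simp_all add: a_def b_def x_def y_def N_def g algebra_simps)
    have e: "weighted_gegenbauer (Suc 0) n t = (a - b) / (4 * (N + 1))" "iter_int 2 (weighted_gegenbauer (Suc 0) n) t = (x - y) / (4 * (N + 1))"
      using iter_int_weighted_gegenbauer_Suc[OF assms, of 2 0 n] by (simp_all add: a_def b_def x_def y_def N_def)
    have N: "4 * (N + 1) > 0" by (simp add: N_def)
    have d: "(N + 2)\<^sup>2 = N\<^sup>2 + 4 * (N + 1)" by (simp add: power2_eq_square algebra_simps)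
    have "(a - b) / K + (M + K) * ((x - y) / K) = x" "(a - b) / K + M * ((x - y) / K) = y"
      if "K > 0" "a = 1 - M * x" "b = 1 - (M + K) * y" for K M
      unfolding that(2,3) using that(1) by (simp_all add: field_simps)
    from this[OF N, of "N\<^sup>2"] ab
    have "(a - b) / (4 * (N + 1)) + (N + 2)\<^sup>2 * ((x - y) / (4 * (N + 1))) = x"
      "(a - b) / (4 * (N + 1)) + N\<^sup>2 * ((x - y) / (4 * (N + 1))) = y"
      unfolding d by blast+
    then show ?case unfolding e x_def y_def N_def by (simp del: weighted_gegenbauer.simps)
  next
    case (Suc l)
    define a b x y where "a = weighted_gegenbauer (Suc l) n t" and "b = weighted_gegenbauer (Suc l) (n + 2) t"
      and "x = iter_int 2 (weighted_gegenbauer (Suc l) n) t" and "y = iter_int 2 (weighted_gegenbauer (Suc l) (n + 2)) t"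
    define N L where "N = real n" and "L = real l + 1"
    \<comment> \<open>The second equation at n and the first at n + 2 share the right-hand side
      \<open>iter_int 2 (weighted_gegenbauer l (n + 2)) t\<close>.\<close>
    have 1: "a + N\<^sup>2 * x = b + (N + 2 * L + 2)\<^sup>2 * y"
    proof -
      have "real (n + 2) + 2 * real l + 2 = N + 2 * L + 2" by (simp add: N_def L_def)
      then show ?thesis
        using trans[OF conjunct2[OF Suc[of n]] conjunct1[OF Suc[of "n + 2"], symmetric]]
        unfolding a_def b_def x_def y_def N_def[symmetric] by (simp only:)
    qed
    have e: "weighted_gegenbauer (Suc (Suc l)) n t = (a - b) / (4 * (L + 1) * (N + L + 1))"
      "iter_int 2 (weighted_gegenbauer (Suc (Suc l)) n) t = (x - y) / (4 * (L + 1) * (N + L + 1))"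
      unfolding iter_int_weighted_gegenbauer_Suc[OF assms, of 2 "Suc l" n] weighted_gegenbauer.simps(2)[of "Suc l"]
      by (simp_all add: a_def b_def x_def y_def N_def L_def add_ac)
    have K: "4 * (L + 1) * (N + L + 1) > 0" by (simp add: N_def L_def)
    have d: "(N + 2 * L + 2)\<^sup>2 = N\<^sup>2 + 4 * (L + 1) * (N + L + 1)"
      by (simp add: power2_eq_square algebra_simps)
    have a: "a = b + (N + 2 * L + 2)\<^sup>2 * y - N\<^sup>2 * x" using 1 by simp
    have "(a - b) / K + (M + K) * ((x - y) / K) = x" "(a - b) / K + M * ((x - y) / K) = y"
      if "K > 0" "a = b + (M + K) * y - M * x" for K M
      unfolding that(2) using that(1) by (simp_all add: field_simps)
    from this[OF K, of "N\<^sup>2"] a have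
      "weighted_gegenbauer (Suc (Suc l)) n t + (N + 2 * L + 2)\<^sup>2 * iter_int 2 (weighted_gegenbauer (Suc (Suc l)) n) t = x"
      "weighted_gegenbauer (Suc (Suc l)) n t + N\<^sup>2 * iter_int 2 (weighted_gegenbauer (Suc (Suc l)) n) t = y"
      unfolding e d by simp_all
    moreover have "N + 2 * L + 2 = real n + 2 * real (Suc l) + 2" by (simp add: N_def L_def)
    ultimately show ?case unfolding x_def y_def N_def[symmetric] by (simp only: simp_thms)
  qed
  then show "weighted_gegenbauer (Suc l) n t + (real n + 2 * real l + 2)\<^sup>2 * iter_int 2 (weighted_gegenbauer (Suc l) n) t = iter_int 2 (weighted_gegenbauer l n) t"
    and "weighted_gegenbauer (Suc l) n t + (real n)\<^sup>2 * iter_int 2 (weighted_gegenbauer (Suc l) n) t = iter_int 2 (weighted_gegenbauer l (n + 2)) t"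
    by auto
qed

definition integrated_gegenbauer :: "nat \<Rightarrow> nat \<Rightarrow> real \<Rightarrow> real" where
  "integrated_gegenbauer l n = iter_int (l + 2) (weighted_gegenbauer l n)"

text \<open>Variation of constants for \<open>y''' + m\<^sup>2 y' = integrated_gegenbauer l n\<close> with zero initial values.\<close>

lemma integrated_gegenbauer_Suc_has_integral:
  fixes l n :: nat
  defines "m \<equiv> real n + 2 * real l + 2"
  assumes t: "t \<ge> 0"
  shows "((\<lambda>u. (1 - cos (m * (t - u))) / m\<^sup>2 * integrated_gegenbauer l n u) has_integral integrated_gegenbauer (Suc l) n t) {0..t}"
proof -
  have m: "m > 0" by (simp add: m_def)
  define v where "v = weighted_gegenbauer (Suc l) n"
  have cv: "continuous_on {0..t} v" unfolding v_def by (rule continuous_on_weighted_gegenbauer)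
  define y y1 y2 y3 where "y = iter_int (Suc (l + 2)) v" and "y1 = iter_int (Suc (l + 1)) v"
    and "y2 = iter_int (Suc l) v" and "y3 = iter_int l v"
  have ode: "y3 u + m\<^sup>2 * y1 u = integrated_gegenbauer l n u" if u: "u \<in> {0..t}" for u
  proof -
    have "integrated_gegenbauer l n u = iter_int l (iter_int 2 (weighted_gegenbauer l n)) u"
      by (simp only: integrated_gegenbauer_def iter_int_add_index)
    also have "\<dots> = iter_int l (\<lambda>x. 1 * v x + m\<^sup>2 * iter_int 2 v x) u"
      by (rule iter_int_cong[of t]) (use u weighted_gegenbauer_ode(1) in \<open>auto simp: v_def m_def\<close>)
    also have "\<dots> = 1 * iter_int l v u + m\<^sup>2 * iter_int l (iter_int 2 v) u"
      by (rule iter_int_add_mult[OF cv continuous_on_iter_int[OF cv] u])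
    also have "iter_int l (iter_int 2 v) = y1"
      by (simp add: y1_def flip: iter_int_add_index)
    finally show ?thesis by (simp add: y3_def)
  qed
  \<comment> \<open>Found by integrating the kernel against y''' + m^2 y' by parts. At u = t kernel
    and sine vanish and y remains; at u = 0 all iterated integrals vanish.\<close>
  define \<Phi> where "\<Phi> u = (1 - cos (m * (t - u))) / m\<^sup>2 * y2 u + sin (m * (t - u)) / m * y1 u + y u" for u
  have "(\<Phi> has_real_derivative (1 - cos (m * (t - u))) / m\<^sup>2 * integrated_gegenbauer l n u) (at u within {0..t})"
    if u: "u \<in> {0..t}" for u
  proof -
    have d: "(y has_real_derivative y1 u) (at u within {0..t})"
      "(y1 has_real_derivative y2 u) (at u within {0..t})"
      "(y2 has_real_derivative y3 u) (at u within {0..t})"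
      unfolding y_def y1_def y2_def y3_def
      using iter_int_has_real_derivative[OF cv u] by (simp_all add: numeral_2_eq_2 del: iter_int.simps)
    have "(\<Phi> has_real_derivative
        (- sin (m * (t - u)) / m * y2 u + (1 - cos (m * (t - u))) / m\<^sup>2 * y3 u)
         + (- cos (m * (t - u)) * y1 u + sin (m * (t - u)) / m * y2 u) + y1 u) (at u within {0..t})"
      unfolding \<Phi>_def
    proof (rule DERIV_cong[OF DERIV_add[OF DERIV_add[OF DERIV_mult[OF _ d(3)] DERIV_mult[OF _ d(2)]] d(1)]])
      show "((\<lambda>u. (1 - cos (m * (t - u))) / m\<^sup>2) has_real_derivative - sin (m * (t - u)) / m) (at u within {0..t})"
        using m by (auto intro!: derivative_eq_intros simp: power2_eq_square)
      show "((\<lambda>u. sin (m * (t - u)) / m) has_real_derivative - cos (m * (t - u))) (at u within {0..t})"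
        using m by (auto intro!: derivative_eq_intros)
    qed (simp add: algebra_simps)
    also have "(- sin (m * (t - u)) / m * y2 u + (1 - cos (m * (t - u))) / m\<^sup>2 * y3 u)
         + (- cos (m * (t - u)) * y1 u + sin (m * (t - u)) / m * y2 u) + y1 u
       = (1 - cos (m * (t - u))) / m\<^sup>2 * (y3 u + m\<^sup>2 * y1 u)"
      using m by (simp add: field_simps)
    finally show ?thesis by (simp only: ode[OF u])
  qed
  then have "((\<lambda>u. (1 - cos (m * (t - u))) / m\<^sup>2 * integrated_gegenbauer l n u) has_integral (\<Phi> t - \<Phi> 0)) {0..t}"
    using t by (intro fundamental_theorem_of_calculus)
      (auto simp: has_real_derivative_iff_has_vector_derivative)
  moreover have "\<Phi> t = integrated_gegenbauer (Suc l) n t" by (simp add: \<Phi>_def y_def v_def integrated_gegenbauer_def)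
  moreover have "\<Phi> 0 = 0" by (simp add: \<Phi>_def y_def y1_def y2_def)
  ultimately show ?thesis by simp
qed

text \<open>At n = 0 the first identity reads 0 = 0, so that value is integrated directly.\<close>

lemma integrated_gegenbauer_0:
  assumes "t \<ge> 0"
  shows "(real n)\<^sup>2 * integrated_gegenbauer 0 n t = 1 - cos (real n * t)"
    and "n = 0 \<Longrightarrow> integrated_gegenbauer 0 n t = t\<^sup>2 / 2"
proof -
  have g: "weighted_gegenbauer 0 n = (\<lambda>x. cos (real n * x))" by (rule ext) simp
  show "(real n)\<^sup>2 * integrated_gegenbauer 0 n t = 1 - cos (real n * t)"
    using iter_int_2_cos[OF assms, of "real n"] unfolding integrated_gegenbauer_def g add_0 by linarith
  assume n: "n = 0"
  have g1: "weighted_gegenbauer 0 n = (\<lambda>x. 1)" by (rule ext) (simp add: n)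
  have "iter_int (Suc 0) (\<lambda>x. 1) s = s" if "s \<ge> 0" for s :: real
    using that by simp
  then have "integral {0..t} (iter_int (Suc 0) (\<lambda>x. 1)) = integral {0..t} (\<lambda>x. x)"
    by (intro integral_cong) auto
  then show "integrated_gegenbauer 0 n t = t\<^sup>2 / 2"
    using assms ident_has_integral[of 0 t] by (simp add: integrated_gegenbauer_def g1 numeral_2_eq_2 integral_unique)
qed

lemma integrated_gegenbauer_nonneg: "t \<ge> 0 \<Longrightarrow> integrated_gegenbauer l n t \<ge> 0"
proof (induction l arbitrary: t)
  case 0
  show ?case
  proof (cases "n = 0")
    case False
    then have "(real n)\<^sup>2 > 0" by simp
    moreover have "(real n)\<^sup>2 * integrated_gegenbauer 0 n t \<ge> 0" using integrated_gegenbauer_0(1)[OF 0] by simp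
    ultimately show ?thesis by (simp add: zero_le_mult_iff)
  next
    case True
    show ?thesis unfolding integrated_gegenbauer_0(2)[OF 0 True] by simp
  qed
next
  case (Suc l)
  show ?case
    by (rule has_integral_nonneg[OF integrated_gegenbauer_Suc_has_integral[OF Suc.prems]])
      (use Suc.IH in \<open>auto intro!: mult_nonneg_nonneg divide_nonneg_nonneg\<close>)
qed

text \<open>Each convolution kernel is at most 2 / n^2 and acts over a length of at most b. The
  decay n^(-2l-2) outweighs the growth n^(2l) in \<open>abs_gegenbauer_le\<close>.\<close>

lemma integrated_gegenbauer_le:
  assumes n: "n \<ge> 1" and t: "t \<in> {0..b}"
  shows "integrated_gegenbauer l n t \<le> 2 / (real n)\<^sup>2 * (2 * b / (real n)\<^sup>2) ^ l"
  using t
proof (induction l arbitrary: t)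
  case 0
  have "(real n)\<^sup>2 > 0" using n by simp
  moreover have "(real n)\<^sup>2 * integrated_gegenbauer 0 n t \<le> 2" using integrated_gegenbauer_0(1)[of t n] 0 cos_ge_minus_one[of "real n * t"] by simp
  ultimately show ?case by (simp add: field_simps)
next
  case (Suc l)
  define M where "M = 2 / (real n)\<^sup>2 * (2 * b / (real n)\<^sup>2) ^ l"
  define m where "m = real n + 2 * real l + 2"
  have M: "M \<ge> 0" using Suc.prems by (auto simp: M_def intro!: mult_nonneg_nonneg zero_le_power divide_nonneg_nonneg)
  have "integrated_gegenbauer (Suc l) n t \<le> t * (2 / (real n)\<^sup>2 * M)"
  proof (rule has_integral_le)
    show "((\<lambda>u. (1 - cos (m * (t - u))) / m\<^sup>2 * integrated_gegenbauer l n u) has_integral integrated_gegenbauer (Suc l) n t) {0..t}"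
      unfolding m_def by (rule integrated_gegenbauer_Suc_has_integral) (use Suc.prems in auto)
    show "((\<lambda>u. 2 / (real n)\<^sup>2 * M) has_integral t * (2 / (real n)\<^sup>2 * M)) {0..t}"
      using has_integral_const_real[of "2 / (real n)\<^sup>2 * M" 0 t] Suc.prems by simp
    fix u assume u: "u \<in> {0..t}"
    show "(1 - cos (m * (t - u))) / m\<^sup>2 * integrated_gegenbauer l n u \<le> 2 / (real n)\<^sup>2 * M"
    proof (rule mult_mono)
      have "1 - cos (m * (t - u)) \<le> 2" using cos_ge_minus_one[of "m * (t - u)"] by linarith
      moreover have "(real n)\<^sup>2 \<le> m\<^sup>2" by (rule power_mono) (auto simp: m_def)
      ultimately show "(1 - cos (m * (t - u))) / m\<^sup>2 \<le> 2 / (real n)\<^sup>2"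
        using n by (intro frac_le) auto
      show "integrated_gegenbauer l n u \<le> M" unfolding M_def by (rule Suc.IH) (use u Suc.prems in auto)
    qed (use u integrated_gegenbauer_nonneg in auto)
  qed
  also have "\<dots> \<le> b * (2 / (real n)\<^sup>2 * M)"
    using Suc.prems M by (intro mult_right_mono) auto
  also have "\<dots> = 2 / (real n)\<^sup>2 * (2 * b / (real n)\<^sup>2) ^ Suc l"
    by (simp add: M_def)
  finally show ?case .
qed

lemma continuous_on_integrated_gegenbauer: "continuous_on {0..b} (integrated_gegenbauer l n)"
  unfolding integrated_gegenbauer_def by (intro continuous_on_iter_int continuous_on_weighted_gegenbauer)

text \<open>The kernel \<open>1 - cos\<close> has isolated zeros, so positivity near \<open>0\<close> spreads to all of \<open>(0, \<infinity>)\<close>.\<close>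

lemma integrated_gegenbauer_Suc_pos:
  assumes e: "e > 0" and pos: "\<And>u. 0 < u \<Longrightarrow> u < e \<Longrightarrow> integrated_gegenbauer l n u > 0" and t: "t > 0"
  shows "integrated_gegenbauer (Suc l) n t > 0"
proof (rule ccontr)
  assume "\<not> integrated_gegenbauer (Suc l) n t > 0"
  then have z: "integrated_gegenbauer (Suc l) n t = 0" using integrated_gegenbauer_nonneg[of t "Suc l" n] t by simp
  define m where "m = real n + 2 * real l + 2"
  have m: "m > 0" by (simp add: m_def)
  define s where "s = min t e"
  have s: "s > 0" using e t by (simp add: s_def)
  have cos1: "cos (m * (t - u)) = 1" if u: "0 < u" "u < s" for u
  proof -
    have "(1 - cos (m * (t - u))) / m\<^sup>2 * integrated_gegenbauer l n u = 0"
    proof (rule has_integral_0_cbox_imp_0[of 0 t "\<lambda>u. (1 - cos (m * (t - u))) / m\<^sup>2 * integrated_gegenbauer l n u" u])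
      show "continuous_on (cbox 0 t) (\<lambda>u. (1 - cos (m * (t - u))) / m\<^sup>2 * integrated_gegenbauer l n u)"
        using m by (auto intro!: continuous_intros continuous_on_integrated_gegenbauer)
      show "((\<lambda>u. (1 - cos (m * (t - u))) / m\<^sup>2 * integrated_gegenbauer l n u) has_integral 0) (cbox 0 t)"
        using integrated_gegenbauer_Suc_has_integral[of t n l] t z by (simp add: m_def)
    qed (use t u integrated_gegenbauer_nonneg in \<open>auto simp: s_def intro!: mult_nonneg_nonneg divide_nonneg_nonneg\<close>)
    moreover have "integrated_gegenbauer l n u > 0" using u pos by (simp add: s_def)
    ultimately show ?thesis using m by simp
  qed
  \<comment> \<open>The points s/2 and s/2 + d lie in (0, s), and the phases there differ by m d <
    pi, so the cosine cannot be 1 at both.\<close>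
  define d where "d = min (s / 4) (pi / (2 * m))"
  have "d > 0" "d \<le> s / 4" "d \<le> pi / (2 * m)" using s m by (auto simp: d_def)
  moreover from this m have "m * d \<le> pi / 2" by (simp add: field_simps)
  ultimately have d: "0 < d" "d < s / 2" "m * d < pi" using s pi_gt_zero by linarith+
  have "cos (m * (t - s / 2)) = 1" "cos (m * (t - (s / 2 + d))) = 1"
    using cos1[of "s / 2"] cos1[of "s / 2 + d"] d s by auto
  moreover have "m * (t - (s / 2 + d)) = m * (t - s / 2) - m * d" by (simp add: algebra_simps)
  moreover have "sin (m * (t - s / 2)) = 0" if "cos (m * (t - s / 2)) = 1"
    using that sin_cos_squared_add[of "m * (t - s / 2)"] by simp
  ultimately have "cos (m * d) = 1" by (simp add: cos_diff)
  moreover have "cos (m * d) < cos 0"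
    using d m by (intro cos_monotone_0_pi) auto
  ultimately show False by simp
qed

text \<open>At l = 0 and n > 0 the function (1 - cos(n t)) / n^2 is positive near 0 but has further
  zeros; one convolution then gives positivity on the whole half-line.\<close>

lemma integrated_gegenbauer_pos: "t > 0 \<Longrightarrow> l \<ge> 1 \<Longrightarrow> integrated_gegenbauer l n t > 0"
proof -
  have "\<exists>e>0. \<forall>u. 0 < u \<longrightarrow> u < e \<longrightarrow> integrated_gegenbauer 0 n u > 0"
  proof (cases "n = 0")
    case True
    have "integrated_gegenbauer 0 n u > 0" if "0 < u" for u
      unfolding integrated_gegenbauer_0(2)[OF less_imp_le[OF that] True] using that by simp
    then show ?thesis by (intro exI[of _ 1]) auto
  next
    case False
    have "integrated_gegenbauer 0 n u > 0" if "0 < u" "u < pi / real n" for u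
    proof -
      have "cos (real n * u) < cos 0"
        using that False by (intro cos_monotone_0_pi) (auto simp: field_simps)
      then have "(real n)\<^sup>2 * integrated_gegenbauer 0 n u > 0" using integrated_gegenbauer_0(1)[of u n] that by simp
      then show ?thesis by (simp add: zero_less_mult_iff)
    qed
    then show ?thesis using False by (intro exI[of _ "pi / real n"]) auto
  qed
  then have "\<forall>t>0. integrated_gegenbauer (Suc k) n t > 0" for k
  proof (induction k)
    case 0
    then show ?case using integrated_gegenbauer_Suc_pos by blast
  next
    case (Suc k)
    then show ?case using integrated_gegenbauer_Suc_pos[of 1 "Suc k" n] by auto
  qed
  then show "t > 0 \<Longrightarrow> l \<ge> 1 \<Longrightarrow> integrated_gegenbauer l n t > 0" by (cases l) auto
qed

section \<open>Testing a convex function against a second derivative\<close>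

lemma integrate_by_parts:
  fixes f g f' g' :: "real \<Rightarrow> real"
  assumes "a \<le> b"
    and f: "\<And>x. x \<in> {a..b} \<Longrightarrow> (f has_real_derivative f' x) (at x within {a..b})"
    and g: "\<And>x. x \<in> {a..b} \<Longrightarrow> (g has_real_derivative g' x) (at x within {a..b})"
    and cont: "continuous_on {a..b} f'" "continuous_on {a..b} g'"
  shows "integral {a..b} (\<lambda>x. f x * g' x) = f b * g b - f a * g a - integral {a..b} (\<lambda>x. f' x * g x)"
proof -
  have cf: "continuous_on {a..b} f" "continuous_on {a..b} g"
    by (rule DERIV_continuous_on, rule f, assumption) (rule DERIV_continuous_on, rule g, assumption)
  have "((\<lambda>x. f x * g' x + f' x * g x) has_integral (f b * g b - f a * g a)) {a..b}"
    by (rule fundamental_theorem_of_calculus[OF assms(1)])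
      (auto intro!: derivative_eq_intros f g simp: has_real_derivative_iff_has_vector_derivative[symmetric])
  moreover have "(\<lambda>x. f x * g' x) integrable_on {a..b}" "(\<lambda>x. f' x * g x) integrable_on {a..b}"
    by (intro integrable_continuous_real continuous_intros cf cont)+
  then have "integral {a..b} (\<lambda>x. f x * g' x + f' x * g x) = integral {a..b} (\<lambda>x. f x * g' x) + integral {a..b} (\<lambda>x. f' x * g x)"
    by (rule integral_add)
  ultimately show ?thesis by (simp add: integral_unique)
qed

text \<open>Both x + e and y are convex combinations of x and y + e, with exchanged weights; the two
  convexity inequalities are added.\<close>

lemma convex_on_increment_mono:
  fixes h :: "real \<Rightarrow> real"
  assumes h: "convex_on {a..b} h" and "a \<le> x" "x \<le> y" "y + e \<le> b" "e > 0"
  shows "h (x + e) - h x \<le> h (y + e) - h y"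
proof (cases "x = y")
  case False
  then have xy: "x < y" using assms by simp
  define D where "D = y + e - x"
  have D: "D > 0" using xy assms by (simp add: D_def)
  have 1: "h ((1 - u) * x + u * (y + e)) \<le> (1 - u) * h x + u * h (y + e)" if "0 \<le> u" "u \<le> 1" for u
    using convex_onD[OF h that, of x "y + e"] assms xy by simp
  have "h (x + e) \<le> (1 - e / D) * h x + e / D * h (y + e)"
  proof -
    have "(1 - u) * x + u * (y + e) = x + u * D" for u by (simp add: D_def algebra_simps)
    then have "(1 - e / D) * x + e / D * (y + e) = x + e / D * D" .
    also have "\<dots> = x + e" using D by simp
    finally show ?thesis using 1[of "e / D"] D assms xy by (simp add: D_def)
  qed
  moreover have "h y \<le> e / D * h x + (1 - e / D) * h (y + e)"
  proof -
    have "(1 - (1 - u)) * x + (1 - u) * (y + e) = y + e - u * D" for u by (simp add: D_def algebra_simps)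
    then have "(1 - (1 - e / D)) * x + (1 - e / D) * (y + e) = y + e - e / D * D" .
    also have "\<dots> = y" using D by simp
    finally show ?thesis using 1[of "1 - e / D"] D assms xy by (simp add: D_def)
  qed
  ultimately show ?thesis by (simp add: algebra_simps)
qed simp

text \<open>The zero function is the tangent at b and hence a lower bound. Secant slopes towards b
  increase, which gives monotonicity.\<close>

lemma convex_on_nonneg_antimono:
  fixes h :: "real \<Rightarrow> real"
  assumes h: "convex_on {a..b} h" and ab: "a < b" and hb: "h b = 0"
    and d: "(h has_real_derivative 0) (at b within {a..b})"
  shows "x \<in> {a..b} \<Longrightarrow> h x \<ge> 0" and "a \<le> x \<Longrightarrow> x \<le> y \<Longrightarrow> y \<le> b \<Longrightarrow> h y \<le> h x"
proof -
  have nonneg: "h x \<ge> 0" if x: "x \<in> {a..b}" for x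
  proof (cases "x = b")
    case False
    then have xb: "x < b" using x by auto
    have lim: "((\<lambda>y. (h y - h b) / (y - b)) \<longlongrightarrow> 0) (at b within {a..b})"
      using d by (simp add: has_field_derivative_iff)
    have "at b within {a..b} \<noteq> bot"
      using ab by (simp add: trivial_limit_within islimpt_Icc)
    moreover have "eventually (\<lambda>y. h x / (x - b) \<le> (h y - h b) / (y - b)) (at b within {a..b})"
    proof -
      have "eventually (\<lambda>y. y \<in> {x<..}) (at b within {a..b})"
        unfolding eventually_at_topological using xb by (intro exI[of _ "{x<..}"]) auto
      moreover have "eventually (\<lambda>y. y \<in> {a..b} \<and> y \<noteq> b) (at b within {a..b})"
        by (simp add: eventually_at_filter)
      ultimately show ?thesis
      proof eventually_elim
        case (elim y)
        then show ?case using convex_on_slope_le(2)[OF h, of x b y] x ab hb by auto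
      qed
    qed
    ultimately have "h x / (x - b) \<le> 0"
      using tendsto_lowerbound[OF lim] by blast
    then show ?thesis using xb by (simp add: divide_le_0_iff)
  qed (use hb in simp)
  show "x \<in> {a..b} \<Longrightarrow> h x \<ge> 0" by (rule nonneg)
  assume xy: "a \<le> x" "x \<le> y" "y \<le> b"
  show "h y \<le> h x"
  proof (cases "x < y \<and> y < b")
    case True
    have "(h x - h b) / (x - b) \<le> (h y - h b) / (y - b)"
      using convex_on_slope_le(2)[OF h, of x b y] True xy by auto
    then have "h y / (b - y) \<le> h x / (b - x)" 
      using hb minus_divide_right[of "h x" "b - x"] minus_divide_right[of "h y" "b - y"] by simp
    then have "h y \<le> h x / (b - x) * (b - y)" using True by (simp add: field_simps)
    also have "\<dots> \<le> h x / (b - x) * (b - x)"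
      using True xy nonneg[of x] by (intro mult_left_mono) auto
    finally show ?thesis using True by simp
  next
    case False
    then show ?thesis using xy nonneg[of x] hb by (cases "x = y") auto
  qed
qed

text \<open>Formally the left-hand side is \<open>\<integral> \<psi> h''\<close>.  The convex function is mollified by averaging over
  \<open>[x, x + e]\<close>; the derivative of the average is monotone and continuous, which allows integration by
  parts and the second mean value theorem.\<close>

lemma convex_second_derivative_test:
  fixes h \<psi> \<psi>' \<psi>'' :: "real \<Rightarrow> real"
  assumes b: "b > 0" and h: "convex_on {0..b} h" and ch: "continuous_on {0..b} h" and hb: "h b = 0"
    and db: "(h has_real_derivative 0) (at b within {0..b})"
    and d0: "(h has_real_derivative D) (at 0 within {0..b})"
    and \<psi>: "\<And>x. x \<in> {0..b} \<Longrightarrow> (\<psi> has_real_derivative \<psi>' x) (at x within {0..b})"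
    and \<psi>': "\<And>x. x \<in> {0..b} \<Longrightarrow> (\<psi>' has_real_derivative \<psi>'' x) (at x within {0..b})"
    and \<psi>'': "continuous_on {0..b} \<psi>''"
    and nonneg: "\<And>x. x \<in> {0..b} \<Longrightarrow> \<psi> x \<ge> 0"
  shows "integral {0..b} (\<lambda>x. h x * \<psi>'' x) + h 0 * \<psi>' 0 - D * \<psi> 0 \<ge> 0"
proof -
  note h_nonneg = convex_on_nonneg_antimono(1)[OF h b hb db]
  note h_anti = convex_on_nonneg_antimono(2)[OF h b hb db]
  \<comment> \<open>Extension by 0 makes averages over [x, x + e] available up to x = b;
    antitonicity and monotone increments persist.\<close>
  define H where "H x = (if x \<le> b then h x else 0)" for x
  have cH: "continuous_on {0..c} H" for c
    unfolding H_def
    by (rule continuous_on_cases_le[where h = "\<lambda>x. x"])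
      (use hb in \<open>auto intro!: continuous_intros intro: continuous_on_subset[OF ch]\<close>)
  have H_anti: "H y \<le> H x" if "0 \<le> x" "x \<le> y" for x y
    using h_anti[of x y] h_nonneg[of x] that by (auto simp: H_def)
  have H_incr: "H (x + e) - H x \<le> H (y + e) - H y" if "0 \<le> x" "x \<le> y" "e > 0" for x y e
  proof -
    consider "y + e \<le> b" | "y + e > b" "x + e > b" | "y + e > b" "x + e \<le> b" by linarith
    then show ?thesis
    proof cases
      case 1
      then show ?thesis using convex_on_increment_mono[OF h, of x y e] that by (simp add: H_def)
    next
      case 2
      then show ?thesis using H_anti[of x y] that by (simp add: H_def)
    next
      case 3
      \<comment> \<open>Only [y, y + e] overhangs b; the interval [b - e, b] mediates the
        comparison.\<close>
      have "h (x + e) - h x \<le> h (b - e + e) - h (b - e)"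
        by (rule convex_on_increment_mono[OF h]) (use that 3 in auto)
      moreover have "H y \<le> H (b - e)" by (rule H_anti) (use that 3 in auto)
      ultimately show ?thesis using 3 that hb by (simp add: H_def)
    qed
  qed
  have cd: "continuous_on {0..b} \<psi>'" 
    by (rule DERIV_continuous_on, rule \<psi>', assumption)
  \<comment> \<open>\<open>F e\<close> averages \<open>H\<close> over [x, x + e]; its derivative
    \<open>q e\<close> is continuous and monotone even where \<open>h\<close> has corners.\<close>
  define F where "F e x = (integral {0..x + e} H - integral {0..x} H) / e" for e x
  define q where "q e x = (H (x + e) - H x) / e" for e x
  define I where "I = integral {0..b} (\<lambda>x. \<bar>\<psi>'' x\<bar>)"
  define G where "G e = integral {0..b} (\<lambda>x. F e x * \<psi>'' x)" for e
  have F_deriv: "(F e has_real_derivative q e x) (at x within {0..b})" if e: "e > 0" and x: "x \<in> {0..b}" for e x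
  proof -
    have d: "((\<lambda>y. integral {0..y} H) has_real_derivative H y) (at y within {0..b + e})" if "y \<in> {0..b + e}" for y
      by (rule integral_has_real_derivative[OF cH that])
    have "((\<lambda>x. integral {0..x + e} H) has_real_derivative H (x + e)) (at x within {0..b})"
    proof -
      have "((\<lambda>y. integral {0..y} H) has_real_derivative H (x + e)) (at (x + e) within (\<lambda>x. x + e) ` {0..b})"
        by (rule DERIV_subset[OF d]) (use x e in auto)
      moreover have "((\<lambda>x. x + e) has_real_derivative 1) (at x within {0..b})"
        by (auto intro!: derivative_eq_intros)
      ultimately show ?thesis
        using DERIV_image_chain[of "\<lambda>y. integral {0..y} H" "H (x + e)" "\<lambda>x. x + e" x "{0..b}" 1]
        by (simp add: o_def)
    qed
    moreover have "((\<lambda>y. integral {0..y} H) has_real_derivative H x) (at x within {0..b})"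
      by (rule integral_has_real_derivative[OF cH x])
    ultimately show ?thesis unfolding F_def q_def using e
      by (auto intro!: derivative_eq_intros)
  qed
  have F_between: "H (x + e) \<le> F e x \<and> F e x \<le> H x" if e: "e > 0" and x: "x \<ge> 0" for e x
  proof -
    have int: "H integrable_on {x..x + e}"
      by (rule integrable_continuous_real, rule continuous_on_subset[OF cH[of "x + e"]]) (use x in auto)
    have "integral {0..x} H + integral {x..x + e} H = integral {0..x + e} H"
      by (rule Henstock_Kurzweil_Integration.integral_combine) (use x e cH in \<open>auto intro: integrable_continuous_real\<close>)
    then have F: "F e x = integral {x..x + e} H / e" by (simp add: F_def)
    have "integral {x..x + e} (\<lambda>_. H (x + e)) \<le> integral {x..x + e} H"
      by (rule integral_le[OF _ int]) (use x H_anti in auto)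
    moreover have "integral {x..x + e} H \<le> integral {x..x + e} (\<lambda>_. H x)"
      by (rule integral_le[OF int]) (use x H_anti in auto)
    ultimately show ?thesis using e by (simp add: F field_simps)
  qed
  have main: "G e + F e 0 * \<psi>' 0 - (h e - h 0) / e * \<psi> 0 \<ge> 0" if e: "e > 0" "e \<le> b" for e
  proof -
    have q_mono: "q e x \<le> q e y" if "0 \<le> x" "x \<le> y" for x y
      using H_incr[of x y e] that e by (simp add: q_def divide_right_mono)
    have Fb: "F e b = 0"
    proof -
      have "H b = 0" "H (b + e) = 0" using hb e by (simp_all add: H_def)
      then show ?thesis using F_between[of e b] e b by simp
    qed
    have cq: "continuous_on {0..b} (q e)"
    proof -
      have "continuous_on {0..b} (\<lambda>x. H (x + e))"
        by (rule continuous_on_compose2[OF cH[of "b + e"]]) (use e in \<open>auto intro!: continuous_intros\<close>)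
      then show ?thesis unfolding q_def using e cH[of b] by (intro continuous_intros) auto
    qed
    have "G e = F e b * \<psi>' b - F e 0 * \<psi>' 0 - integral {0..b} (\<lambda>x. q e x * \<psi>' x)"
      unfolding G_def
      by (rule integrate_by_parts) (use b e F_deriv \<psi>' cq \<psi>'' in auto)
    \<comment> \<open>Since \<open>q e b = 0\<close>, the second mean value theorem leaves only the
      value of \<open>q e\<close> at 0; what remains is \<open>- q e 0 * \<psi> c\<close>, which is
      nonnegative.\<close>
    moreover obtain c where c: "c \<in> {0..b}" 
      "integral {0..b} (\<lambda>x. q e x * \<psi>' x) = q e 0 * integral {0..c} \<psi>' + q e b * integral {c..b} \<psi>'"
      by (rule second_mean_value_theorem[of \<psi>' 0 b "q e"])
        (use b cd q_mono in \<open>auto intro: integrable_continuous_real\<close>)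
    moreover have "q e b = 0" using hb e by (simp add: q_def H_def)
    moreover have "integral {0..c} \<psi>' = \<psi> c - \<psi> 0"
    proof (rule integral_unique, rule fundamental_theorem_of_calculus)
      fix x assume "x \<in> {0..c}"
      then show "(\<psi> has_vector_derivative \<psi>' x) (at x within {0..c})"
        unfolding has_real_derivative_iff_has_vector_derivative[symmetric]
        by (intro DERIV_subset[OF \<psi>]) (use c in auto)
    qed (use c in auto)
    moreover have "q e 0 * \<psi> c \<le> 0"
      using nonneg[OF c(1)] H_anti[of 0 e] e by (simp add: q_def divide_le_0_iff mult_le_0_iff)
    ultimately have "G e + F e 0 * \<psi>' 0 - q e 0 * \<psi> 0 \<ge> 0" by (simp add: Fb algebra_simps)
    moreover have "q e 0 = (h e - h 0) / e" using e b by (simp add: q_def H_def)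
    ultimately show ?thesis by simp
  qed
  let ?At = "at 0 within {0..b}"
  have ev: "eventually (\<lambda>e. 0 < e \<and> e \<le> b) ?At"
    by (auto simp: eventually_at_filter)
  have h_lim: "(h \<longlongrightarrow> h 0) ?At"
    using ch b by (auto simp: continuous_on_def)
  have F0: "h e \<le> F e 0 \<and> F e 0 \<le> h 0" if "0 < e \<and> e \<le> b" for e
    using F_between[of e 0] that b by (simp add: H_def)
  have F_lim: "((\<lambda>e. F e 0) \<longlongrightarrow> h 0) ?At"
  proof (rule tendsto_sandwich[OF _ _ h_lim tendsto_const])
    show "eventually (\<lambda>e. h e \<le> F e 0) ?At" by (rule eventually_mono[OF ev]) (use F0 in blast)
    show "eventually (\<lambda>e. F e 0 \<le> h 0) ?At" by (rule eventually_mono[OF ev]) (use F0 in blast)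
  qed
  \<comment> \<open>By \<open>H_incr\<close> the drop over a length e is largest at 0, so
    \<open>h 0 - h e\<close> bounds the error of averaging uniformly in x.\<close>
  have G_bound: "\<bar>G e - integral {0..b} (\<lambda>x. h x * \<psi>'' x)\<bar> \<le> (h 0 - h e) * I" if e: "0 < e" "e \<le> b" for e
  proof -
    have cF: "continuous_on {0..b} (F e)"
      by (rule DERIV_continuous_on, rule F_deriv[OF e(1)], assumption)
    have "G e - integral {0..b} (\<lambda>x. h x * \<psi>'' x) = integral {0..b} (\<lambda>x. F e x * \<psi>'' x - h x * \<psi>'' x)"
      unfolding G_def
      by (rule integral_diff[symmetric]) (intro integrable_continuous_real continuous_intros cF \<psi>'' ch)+
    also have "\<bar>\<dots>\<bar> \<le> integral {0..b} (\<lambda>x. (h 0 - h e) * \<bar>\<psi>'' x\<bar>)"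
      unfolding real_norm_def[symmetric]
    proof (rule integral_norm_bound_integral)
      fix x assume x: "x \<in> {0..b}"
      have "H (0 + e) - H 0 \<le> H (x + e) - H x" by (rule H_incr) (use x e in auto)
      then have "\<bar>F e x - h x\<bar> \<le> h 0 - h e"
        using F_between[of e x] x e b by (auto simp: H_def)
      then have "\<bar>F e x - h x\<bar> * \<bar>\<psi>'' x\<bar> \<le> (h 0 - h e) * \<bar>\<psi>'' x\<bar>" by (rule mult_right_mono) simp
      then show "norm (F e x * \<psi>'' x - h x * \<psi>'' x) \<le> (h 0 - h e) * norm (\<psi>'' x)"
        by (simp add: abs_mult left_diff_distrib[symmetric])
    qed (intro integrable_continuous_real continuous_intros cF \<psi>'' ch)+
    finally show ?thesis by (simp add: I_def)
  qed
  have "((\<lambda>e. (h 0 - h e) * I) \<longlongrightarrow> (h 0 - h 0) * I) ?At"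
    by (intro tendsto_intros h_lim)
  then have "((\<lambda>e. (h 0 - h e) * I) \<longlongrightarrow> 0) ?At" by simp
  then have "((\<lambda>e. G e - integral {0..b} (\<lambda>x. h x * \<psi>'' x)) \<longlongrightarrow> 0) ?At"
    by (rule Lim_null_comparison[rotated], intro eventually_mono[OF ev]) (use G_bound in auto)
  then have G_lim: "(G \<longlongrightarrow> integral {0..b} (\<lambda>x. h x * \<psi>'' x)) ?At"
    by (rule LIM_zero_cancel)
  have D_lim: "((\<lambda>e. (h e - h 0) / e) \<longlongrightarrow> D) ?At"
    using d0 by (simp add: has_field_derivative_iff)
  have "?At \<noteq> bot" using b by (simp add: trivial_limit_within islimpt_Icc)
  moreover have "((\<lambda>e. G e + F e 0 * \<psi>' 0 - (h e - h 0) / e * \<psi> 0) \<longlongrightarrow>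
      integral {0..b} (\<lambda>x. h x * \<psi>'' x) + h 0 * \<psi>' 0 - D * \<psi> 0) ?At"
    by (intro tendsto_intros G_lim F_lim D_lim)
  moreover have "eventually (\<lambda>e. G e + F e 0 * \<psi>' 0 - (h e - h 0) / e * \<psi> 0 \<ge> 0) ?At"
    by (rule eventually_mono[OF ev]) (use main in auto)
  ultimately show ?thesis
    by (intro tendsto_lowerbound)
qed

section \<open>Gegenbauer expansions\<close>

text \<open>\<open>gegenbauer l n\<close> has exact degree n, so subtracting a multiple of it
  removes the leading term and induction on the degree applies.\<close>

lemma gegenbauer_basis_induct:
  fixes L :: "real poly \<Rightarrow> real"
  assumes l: "l \<ge> 1"
    and add: "\<And>p q. L (p + q) = L p + L q" and smult: "\<And>c p. L (smult c p) = c * L p"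
    and gegenbauer: "\<And>n. L (gegenbauer l n) = 0"
  shows "L p = 0"
proof (induction "degree p" arbitrary: p rule: less_induct)
  case less
  define n where "n = degree p"
  define c where "c = coeff p n / coeff (gegenbauer l n) n"
  define q where "q = p - smult c (gegenbauer l n)"
  have "coeff (gegenbauer l n) n \<noteq> 0" by (simp add: coeff_gegenbauer[OF l])
  then have cq: "coeff q n = 0" by (simp add: q_def c_def)
  have dq: "degree q \<le> n"
    unfolding q_def by (intro degree_diff_le) (simp_all add: n_def degree_gegenbauer[of l "degree p"] order_trans[OF degree_smult_le])
  have "L q = 0"
  proof (cases "q = 0")
    case True
    then show ?thesis using smult[of 0 0] by simp
  next
    case False
    then have "degree q \<noteq> n" using cq leading_coeff_0_iff by metis
    then show ?thesis using less dq by (simp add: n_def)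
  qed
  moreover have "p = q + smult c (gegenbauer l n)" by (simp add: q_def)
  ultimately show ?case using add[of q "smult c (gegenbauer l n)"] by (simp add: smult gegenbauer)
qed

lemma continuous_poly_approx:
  fixes f :: "real \<Rightarrow> real"
  assumes "continuous_on {-1..1} f" "e > 0"
  obtains p :: "real poly" where "\<And>x. x \<in> {-1..1} \<Longrightarrow> \<bar>f x - poly p x\<bar> < e"
proof -
  obtain g where g: "real_polynomial_function g" "\<And>x. x \<in> {-1..1} \<Longrightarrow> \<bar>f x - g x\<bar> < e"
    using Stone_Weierstrass_real_polynomial_function[OF _ assms] by (metis compact_Icc)
  then obtain a n where "g = (\<lambda>x. \<Sum>i\<le>n. a i * x ^ i)"
    unfolding real_polynomial_function_iff_sum by blast
  then have "g x = poly (\<Sum>i\<le>n. monom (a i) i) x" for x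
    by (simp add: poly_sum poly_monom)
  with g show thesis using that[of "\<Sum>i\<le>n. monom (a i) i"] by simp
qed

text \<open>By assumption f is orthogonal to all polynomials in cos t for the weight sin^(2l).
  Approximating f by such polynomials makes the weighted integral of f^2 vanish; continuity covers
  the endpoints, where the weight is 0.\<close>

lemma weighted_gegenbauer_complete:
  fixes f :: "real \<Rightarrow> real"
  assumes l: "l \<ge> 1" and f: "continuous_on {0..pi} f"
    and z: "\<And>n. integral {0..pi} (\<lambda>t. f t * weighted_gegenbauer l n t) = 0"
    and t: "t \<in> {0..pi}"
  shows "f t = 0"
proof -
  define w where "w t = sin t ^ (2 * l)" for t :: real
  have cw: "continuous_on {0..pi} w" unfolding w_def by (intro continuous_intros)
  have w0: "w t \<ge> 0" for t by (simp add: w_def power_mult)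
  define L where "L p = integral {0..pi} (\<lambda>t. f t * w t * poly p (cos t))" for p
  have ip: "(\<lambda>t. f t * w t * poly p (cos t)) integrable_on {0..pi}" for p
    by (intro integrable_continuous_real continuous_intros f cw)
  have L0: "L p = 0" for p
  proof (rule gegenbauer_basis_induct[OF l])
    show "L (p + q) = L p + L q" for p q
      using integral_add[OF ip[of p] ip[of q]] by (simp add: L_def distrib_left)
    show "L (smult c p) = c * L p" for c p
      unfolding L_def integral_mult_right[symmetric] by (simp add: mult_ac)
    show "L (gegenbauer l n) = 0" for n
    proof -
      obtain k where k: "l = Suc k" using l by (cases l) auto
      define c where "c = (fact n / ((real n + real k + 1) * fact (n + 2 * k + 1) * 2 ^ Suc k * fact (Suc k)) :: real)"
      have "c > 0" unfolding c_def by (intro divide_pos_pos mult_pos_pos) auto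
      moreover have "(\<lambda>t. f t * weighted_gegenbauer l n t) = (\<lambda>t. c * (f t * w t * poly (gegenbauer l n) (cos t)))"
        unfolding k weighted_gegenbauer_eq c_def[symmetric] w_def by (simp add: mult_ac)
      ultimately show ?thesis using z[of n] by (simp add: L_def)
    qed
  qed
  define J where "J = integral {0..pi} (\<lambda>t. \<bar>f t\<bar> * w t)"
  have I: "integral {0..pi} (\<lambda>t. f t * f t * w t) \<le> e * J" if e: "e > 0" for e
  proof -
    have "continuous_on {-1..1} (\<lambda>x. f (arccos x))"
      by (rule continuous_on_compose2[OF f continuous_on_arccos']) (auto simp: arccos_lbound arccos_ubound)
    then obtain p where p: "\<And>x. x \<in> {-1..1} \<Longrightarrow> \<bar>f (arccos x) - poly p x\<bar> < e"
      using continuous_poly_approx[OF _ e] by blast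
    have "integral {0..pi} (\<lambda>t. f t * f t * w t) = integral {0..pi} (\<lambda>t. f t * f t * w t - f t * w t * poly p (cos t))"
      using L0[of p] by (subst integral_diff)
        (auto intro!: integrable_continuous_real continuous_intros f cw simp: L_def)
    also have "\<dots> \<le> integral {0..pi} (\<lambda>t. e * (\<bar>f t\<bar> * w t))"
    proof (rule integral_le)
      fix t assume t: "t \<in> {0..pi}"
      then have "\<bar>f t - poly p (cos t)\<bar> \<le> e" using p[of "cos t"] by (simp add: arccos_cos)
      then have "\<bar>f t\<bar> * w t * \<bar>f t - poly p (cos t)\<bar> \<le> \<bar>f t\<bar> * w t * e"
        by (intro mult_left_mono) (simp_all add: w0)
      then have "\<bar>f t * w t * (f t - poly p (cos t))\<bar> \<le> e * (\<bar>f t\<bar> * w t)"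
        using w0[of t] by (simp add: abs_mult mult_ac)
      then show "f t * f t * w t - f t * w t * poly p (cos t) \<le> e * (\<bar>f t\<bar> * w t)"
        by (simp add: algebra_simps abs_le_iff)
    qed (intro integrable_continuous_real continuous_intros f cw)+
    finally show ?thesis by (simp add: J_def)
  qed
  have "integral {0..pi} (\<lambda>t. f t * f t * w t) \<le> 0"
  proof (rule ccontr)
    assume "\<not> ?thesis"
    then have pos: "integral {0..pi} (\<lambda>t. f t * f t * w t) > 0" (is "?i > 0") by simp
    have J: "J \<ge> 0" unfolding J_def by (rule integral_nonneg)
      (auto intro!: integrable_continuous_real continuous_intros f cw mult_nonneg_nonneg w0)
    \<comment> \<open>The tolerance is chosen to make the bound strictly smaller than the integral;
      adding 1 covers J = 0.\<close>
    have "?i \<le> ?i / (J + 1) * J" using pos J by (intro I) simp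
    also have "\<dots> < ?i" using pos J by (simp add: field_simps)
    finally show False by simp
  qed
  moreover have "integral {0..pi} (\<lambda>t. f t * f t * w t) \<ge> 0"
    by (rule integral_nonneg) (auto intro!: integrable_continuous_real continuous_intros f cw simp: w0)
  ultimately have "integral {0..pi} (\<lambda>t. f t * f t * w t) = 0" by simp
  moreover have "continuous_on {0..pi} (\<lambda>t. f t * f t * w t)" by (intro continuous_intros f cw)
  ultimately have z0: "f t * f t * w t = 0" if "t \<in> {0..pi}" for t
    using integral_eq_0_iff[of 0 pi "\<lambda>t. f t * f t * w t"] w0 that by simp
  have open0: "f t = 0" if "t \<in> {0<..<pi}" for t
  proof -
    have "sin t > 0" using that by (intro sin_gt_zero) auto
    then have "w t \<noteq> 0" by (simp add: w_def)
    moreover have "t \<in> {0..pi}" using that by auto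
    ultimately show ?thesis using z0[of t] by simp
  qed
  have "closure {0<..<pi} = {0..pi}" by (simp add: closure_greaterThanLessThan)
  then show ?thesis using continuous_constant_on_closure[of "{0<..<pi}" f 0 t] f open0 t by simp
qed

text \<open>\<open>H j\<close> stands for the j-th derivative of the profile \<open>H 0\<close>
  relative to [0, pi], and \<open>D\<close> for the one-sided derivative of \<open>H l\<close> at
  0.\<close>

locale polya_profile =
  fixes H :: "nat \<Rightarrow> real \<Rightarrow> real" and l :: nat and D :: real
  assumes l: "l \<ge> 1"
    and deriv: "\<And>j x. j < l \<Longrightarrow> x \<in> {0..pi} \<Longrightarrow> (H j has_real_derivative H (Suc j) x) (at x within {0..pi})"
    and cont: "\<And>j. j \<le> l \<Longrightarrow> continuous_on {0..pi} (H j)"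
    and zero: "\<And>j. j \<le> l \<Longrightarrow> H j pi = 0"
    and convex: "convex_on {0..pi} (\<lambda>x. (-1) ^ l * H l x)"
    and deriv_pi: "(H l has_real_derivative 0) (at pi within {0..pi})"
    and deriv_0: "(H l has_real_derivative D) (at 0 within {0..pi})"
begin

definition h :: "real \<Rightarrow> real" where "h x = (-1) ^ l * H l x"

text \<open>The Gegenbauer coefficient of \<open>H 0\<close> before normalisation; the weight is
  contained in \<open>weighted_gegenbauer\<close>.\<close>

definition moment :: "nat \<Rightarrow> real" where "moment n = integral {0..pi} (\<lambda>t. H 0 t * weighted_gegenbauer l n t)"

text \<open>The boundary terms vanish at pi because \<open>H j\<close> does, and at 0 because
  iterated integrals start there.\<close>

lemma integral_by_parts_iter:
  assumes v: "continuous_on {0..pi} v"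
  shows "j \<le> l \<Longrightarrow> integral {0..pi} (\<lambda>t. H 0 t * v t) = (-1) ^ j * integral {0..pi} (\<lambda>t. H j t * iter_int j v t)"
proof (induction j)
  case (Suc j)
  have "integral {0..pi} (\<lambda>t. H j t * iter_int j v t) = H j pi * iter_int (Suc j) v pi - H j 0 * iter_int (Suc j) v 0
      - integral {0..pi} (\<lambda>t. H (Suc j) t * iter_int (Suc j) v t)"
    by (rule integrate_by_parts)
      (use Suc.prems deriv cont iter_int_has_real_derivative[OF v] continuous_on_iter_int[OF v] in auto)
  then show ?case using Suc zero[of j] by simp
qed simp

lemma h_facts: "convex_on {0..pi} h" "continuous_on {0..pi} h" "h pi = 0"
  "(h has_real_derivative 0) (at pi within {0..pi})"
  "(h has_real_derivative (-1) ^ l * D) (at 0 within {0..pi})"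
proof -
  have h: "h = (\<lambda>x. (-1) ^ l * H l x)" by (rule ext) (simp add: h_def)
  show "convex_on {0..pi} h" unfolding h by (rule convex)
  show "continuous_on {0..pi} h" unfolding h by (intro continuous_intros cont) simp
  show "h pi = 0" by (simp add: h_def zero)
  show "(h has_real_derivative 0) (at pi within {0..pi})"
    using DERIV_cmult[OF deriv_pi, of "(-1) ^ l"] by (simp add: h)
  show "(h has_real_derivative (-1) ^ l * D) (at 0 within {0..pi})"
    unfolding h by (rule DERIV_cmult[OF deriv_0])
qed

lemmas h_nonneg = convex_on_nonneg_antimono(1)[OF h_facts(1) pi_gt_zero h_facts(3,4)]

lemmas second_derivative_test = convex_second_derivative_test[OF pi_gt_zero h_facts]

lemma moment_eq: "moment n = integral {0..pi} (\<lambda>t. h t * iter_int l (weighted_gegenbauer l n) t)"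
  unfolding moment_def integral_by_parts_iter[OF continuous_on_weighted_gegenbauer order_refl]
  by (simp add: h_def mult.assoc flip: integral_mult_right)

lemma integrated_gegenbauer_deriv:
  assumes "x \<in> {0..pi}"
  shows "(integrated_gegenbauer l n has_real_derivative iter_int (Suc l) (weighted_gegenbauer l n) x) (at x within {0..pi})"
    "(iter_int (Suc l) (weighted_gegenbauer l n) has_real_derivative iter_int l (weighted_gegenbauer l n) x) (at x within {0..pi})"
  using iter_int_has_real_derivative[OF continuous_on_weighted_gegenbauer assms, of "Suc l"]
    iter_int_has_real_derivative[OF continuous_on_weighted_gegenbauer assms, of l]
  by (simp_all add: integrated_gegenbauer_def numeral_2_eq_2 del: iter_int.simps)

lemma integrated_gegenbauer_at_0: "integrated_gegenbauer l n 0 = 0"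
  by (simp add: integrated_gegenbauer_def numeral_2_eq_2)

text \<open>The test function is \<open>integrated_gegenbauer l n\<close>, which is nonnegative. It
  and its derivative vanish at 0, so the test yields the moment alone.\<close>

lemma moment_nonneg: "moment n \<ge> 0"
  using second_derivative_test[OF integrated_gegenbauer_deriv continuous_on_iter_int[OF continuous_on_weighted_gegenbauer] integrated_gegenbauer_nonneg, of n]
  by (simp add: moment_eq integrated_gegenbauer_at_0)

text \<open>The test function is \<open>M - integrated_gegenbauer l n\<close>; its value M at 0
  brings in the endpoint derivative D.\<close>

lemma moment_le:
  assumes "\<And>t. t \<in> {0..pi} \<Longrightarrow> integrated_gegenbauer l n t \<le> M"
  shows "moment n \<le> - ((-1) ^ l * D) * M"
proof -
  have "integral {0..pi} (\<lambda>x. h x * - iter_int l (weighted_gegenbauer l n) x) + h 0 * - iter_int (Suc l) (weighted_gegenbauer l n) 0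
      - (-1) ^ l * D * (M - integrated_gegenbauer l n 0) \<ge> 0"
    by (rule second_derivative_test) (use assms in \<open>auto intro!: derivative_eq_intros integrated_gegenbauer_deriv continuous_intros
      continuous_on_iter_int continuous_on_weighted_gegenbauer simp del: iter_int.simps\<close>)
  then show ?thesis by (simp add: moment_eq integrated_gegenbauer_at_0)
qed

text \<open>Strictness is obtained by comparing with a multiple of the double antiderivative of a function
  \<open>max 0 (t - a)\<close>, against which \<open>h\<close> integrates to a positive number.\<close>

lemma moment_pos:
  assumes "\<exists>t\<in>{0..pi}. H l t \<noteq> 0"
  shows "moment n > 0"
proof -
  \<comment> \<open>If \<open>h\<close> vanished on the open interval, continuity would make
    \<open>H l\<close> vanish on all of [0, pi].\<close>
  have "\<exists>s. 0 < s \<and> s < pi \<and> h s > 0"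
  proof (rule ccontr)
    assume "\<not> ?thesis"
    then have z: "h s = 0" if "s \<in> {0<..<pi}" for s
      using that h_nonneg[of s] by force
    have "closure {0<..<pi} = {0..pi}" by (simp add: closure_greaterThanLessThan)
    then have "h t = 0" if "t \<in> {0..pi}" for t
      using continuous_constant_on_closure[of "{0<..<pi}" h 0 t] h_facts(2) z that by simp
    then show False using assms by (auto simp: h_def)
  qed
  then obtain s where s: "0 < s" "s < pi" "h s > 0" by blast
  \<comment> \<open>Below a the comparison function \<open>X\<close> is 0, so it stays under
    \<open>integrated_gegenbauer l n\<close> even though the latter vanishes at 0; moreover
    \<open>k s\<close> is positive.\<close>
  define a where "a = s / 2"
  define k where "k t = max 0 (t - a)" for t
  define X where "X = iter_int 2 k"
  have ck: "continuous_on {0..pi} k" unfolding k_def by (intro continuous_intros)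
  have X1: "iter_int 1 k t = 0" if "t \<in> {0..a}" for t
  proof -
    have "integral {0..t} k = integral {0..t} (\<lambda>_. 0)"
      by (rule integral_cong) (use that in \<open>auto simp: k_def\<close>)
    then show ?thesis by simp
  qed
  have X0: "X t = 0" if "t \<in> {0..a}" for t
  proof -
    have "integral {0..t} (iter_int 1 k) = integral {0..t} (\<lambda>_. 0)"
      by (rule integral_cong) (use X1 that in auto)
    then show ?thesis by (simp add: X_def numeral_2_eq_2)
  qed
  have cX: "continuous_on {0..pi} X" unfolding X_def by (rule continuous_on_iter_int[OF ck])
  have "compact (X ` {0..pi})" by (rule compact_continuous_image[OF cX]) simp
  then obtain B where B: "\<And>t. t \<in> {0..pi} \<Longrightarrow> \<bar>X t\<bar> \<le> B"
    using compact_imp_bounded bounded_iff by (metis imageI real_norm_def)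
  have "\<exists>x\<in>{a..pi}. \<forall>y\<in>{a..pi}. integrated_gegenbauer l n x \<le> integrated_gegenbauer l n y"
    by (rule continuous_attains_inf) (use s in \<open>auto simp: a_def intro!: continuous_on_subset[OF continuous_on_integrated_gegenbauer[of pi]]\<close>)
  then obtain x where x: "x \<in> {a..pi}" "\<And>y. y \<in> {a..pi} \<Longrightarrow> integrated_gegenbauer l n x \<le> integrated_gegenbauer l n y" by blast
  define \<mu> where "\<mu> = integrated_gegenbauer l n x"
  have \<mu>: "\<mu> > 0" unfolding \<mu>_def using x s l by (intro integrated_gegenbauer_pos) (auto simp: a_def)
  have B0: "B \<ge> 0" using B[of 0] by simp
  \<comment> \<open>Chosen so that \<open>c * X\<close> stays below the minimum \<open>\<mu>\<close>
    on [a, pi]; adding 1 avoids division by zero.\<close>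
  define c where "c = \<mu> / (B + 1)"
  have c: "c > 0" using \<mu> B0 by (simp add: c_def)
  have dX: "(X has_real_derivative iter_int 1 k t) (at t within {0..pi})"
    "(iter_int 1 k has_real_derivative k t) (at t within {0..pi})" if "t \<in> {0..pi}" for t
    using iter_int_has_real_derivative[OF ck that, of 1] iter_int_has_real_derivative[OF ck that, of 0]
    by (simp_all add: X_def numeral_2_eq_2)
  have "integral {0..pi} (\<lambda>t. h t * (iter_int l (weighted_gegenbauer l n) t - c * k t))
      + h 0 * (iter_int (Suc l) (weighted_gegenbauer l n) 0 - c * iter_int 1 k 0)
      - (-1) ^ l * D * (integrated_gegenbauer l n 0 - c * X 0) \<ge> 0"
  proof (rule second_derivative_test)
    fix t assume t: "t \<in> {0..pi}"
    show "((\<lambda>t. integrated_gegenbauer l n t - c * X t) has_real_derivative iter_int (Suc l) (weighted_gegenbauer l n) t - c * iter_int 1 k t) (at t within {0..pi})"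
      by (intro DERIV_diff integrated_gegenbauer_deriv DERIV_cmult dX t)
    show "((\<lambda>t. iter_int (Suc l) (weighted_gegenbauer l n) t - c * iter_int 1 k t) has_real_derivative iter_int l (weighted_gegenbauer l n) t - c * k t) (at t within {0..pi})"
      by (intro DERIV_diff integrated_gegenbauer_deriv DERIV_cmult dX t)
    show "0 \<le> integrated_gegenbauer l n t - c * X t"
    proof (cases "t \<le> a")
      case True
      then show ?thesis using X0[of t] t integrated_gegenbauer_nonneg[of t l n] by simp
    next
      case False
      have "c * X t \<le> c * B" using B[OF t] c by (intro mult_left_mono) auto
      also have "\<dots> \<le> \<mu>" using \<mu> B0 by (simp add: c_def field_simps)
      also have "\<mu> \<le> integrated_gegenbauer l n t" unfolding \<mu>_def by (rule x(2)) (use False t in auto)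
      finally show ?thesis by simp
    qed
  qed (intro continuous_intros continuous_on_iter_int continuous_on_weighted_gegenbauer ck)
  moreover have "X 0 = 0" "iter_int 1 k 0 = 0" using X0[of 0] s by (simp_all add: a_def)
  moreover have "integral {0..pi} (\<lambda>t. h t * (iter_int l (weighted_gegenbauer l n) t - c * k t))
     = moment n - c * integral {0..pi} (\<lambda>t. h t * k t)"
  proof -
    have "integral {0..pi} (\<lambda>t. h t * iter_int l (weighted_gegenbauer l n) t - c * (h t * k t))
      = moment n - integral {0..pi} (\<lambda>t. c * (h t * k t))"
      unfolding moment_eq by (rule integral_diff)
        (intro integrable_continuous_real continuous_intros continuous_on_iter_int continuous_on_weighted_gegenbauer ck h_facts)+
    then show ?thesis by (simp add: algebra_simps)
  qed
  ultimately have "moment n \<ge> c * integral {0..pi} (\<lambda>t. h t * k t)"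
    by (simp add: integrated_gegenbauer_at_0)
  moreover have "integral {0..pi} (\<lambda>t. h t * k t) > 0"
  proof -
    have chk: "continuous_on {0..pi} (\<lambda>t. h t * k t)" by (intro continuous_intros h_facts ck)
    have nn: "h t * k t \<ge> 0" if "t \<in> {0..pi}" for t using h_nonneg[OF that] by (simp add: k_def)
    have "h s * k s \<noteq> 0" using s by (simp add: k_def a_def)
    then have "integral {0..pi} (\<lambda>t. h t * k t) \<noteq> 0"
      using integral_eq_0_iff[OF chk pi_gt_zero nn] s by force
    moreover have "integral {0..pi} (\<lambda>t. h t * k t) \<ge> 0"
      by (rule integral_nonneg) (use nn integrable_continuous_real[OF chk] in auto)
    ultimately show ?thesis by simp
  qed
  ultimately show ?thesis using mult_pos_pos[OF c] by fastforce
qed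

definition fourier_coef :: "nat \<Rightarrow> real" where "fourier_coef n = moment n / (2 ^ (l - 1) * pi / (4 ^ l * fact l))"

text \<open>The series converges uniformly by the Weierstrass test, its sum has the moments of
  \<open>H 0\<close> by orthogonality, and completeness identifies the two.\<close>

lemma expansion_sums:
  assumes t: "t \<in> {0..pi}"
  shows "(\<lambda>n. fourier_coef n * poly (gegenbauer l n) (cos t)) sums H 0 t"
proof -
  define Z where "Z = 2 ^ (l - 1) * pi / (4 ^ l * fact l)"
  have Z: "Z > 0" by (simp add: Z_def)
  have fourier_coef_eq: "fourier_coef n = moment n / Z" for n by (simp add: fourier_coef_def Z_def)
  have A0: "fourier_coef n \<ge> 0" for n using moment_nonneg Z by (simp add: fourier_coef_eq)
  define D' where "D' = - ((-1) ^ l * D)"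
  define K where "K = D' / Z * 2 * (2 * pi) ^ l * (1 + real l) ^ (2 * l)"
  define f where "f n t = fourier_coef n * poly (gegenbauer l n) (cos t)" for n t
  \<comment> \<open>The lower and upper bounds for \<open>moment 1\<close> together force this
    sign.\<close>
  have D': "D' \<ge> 0"
  proof -
    have "0 \<le> moment 1" by (rule moment_nonneg)
    also have "moment 1 \<le> D' * (2 / (real 1)\<^sup>2 * (2 * pi / (real 1)\<^sup>2) ^ l)"
      unfolding D'_def by (rule moment_le, rule integrated_gegenbauer_le) auto
    finally have "0 \<le> D' * (2 / (real 1)\<^sup>2 * (2 * pi / (real 1)\<^sup>2) ^ l)" .
    moreover have "0 < 2 / (real 1)\<^sup>2 * (2 * pi / (real 1)\<^sup>2) ^ l" by simp
    ultimately show ?thesis using zero_le_mult_iff not_less by metis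
  qed
  have bound: "norm (f n t) \<le> K * inverse (real n ^ 2)" if n: "n \<ge> 1" and t: "t \<in> {0..pi}" for n t
  proof -
    have "fourier_coef n \<le> D' * (2 / (real n)\<^sup>2 * (2 * pi / (real n)\<^sup>2) ^ l) / Z"
      unfolding fourier_coef_eq D'_def by (intro divide_right_mono moment_le integrated_gegenbauer_le n) (use Z in auto)
    moreover have "\<bar>poly (gegenbauer l n) (cos t)\<bar> \<le> ((1 + real l) * real n) ^ (2 * l)"
    proof -
      have "\<bar>poly (gegenbauer l n) (cos t)\<bar> \<le> real (n + l) ^ (2 * l)"
        by (rule abs_gegenbauer_le) (simp add: abs_le_iff)
      also have "real (n + l) \<le> (1 + real l) * real n"
        using n mult_left_mono[of 1 "real n" "real l"] by (simp add: algebra_simps)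
      then have "real (n + l) ^ (2 * l) \<le> ((1 + real l) * real n) ^ (2 * l)"
        by (rule power_mono) simp
      finally show ?thesis .
    qed
    ultimately have "fourier_coef n * \<bar>poly (gegenbauer l n) (cos t)\<bar>
       \<le> D' * (2 / (real n)\<^sup>2 * (2 * pi / (real n)\<^sup>2) ^ l) / Z * ((1 + real l) * real n) ^ (2 * l)"
      using A0[of n] by (intro mult_mono) auto
    also have "\<dots> = K * inverse (real n ^ 2)"
    proof -
      have e: "D' * (2 / M * (c / P)) / Z * (e * P) = D' / Z * 2 * c * e * inverse M" if "P > 0" for M P c e :: real
        using that by (simp add: field_simps)
      have pos: "((real n)\<^sup>2) ^ l > 0" using n by simp
      have pw: "((1 + real l) * real n) ^ (2 * l) = (1 + real l) ^ (2 * l) * ((real n)\<^sup>2) ^ l"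
        by (simp only: power_mult_distrib power_mult)
      show ?thesis unfolding K_def power_divide pw by (rule e[OF pos])
    qed
    finally show ?thesis using A0[of n] by (simp add: f_def abs_mult)
  qed
  have sum: "summable (\<lambda>n. K * inverse (real n ^ 2))"
    by (intro summable_mult inverse_power_summable) simp
  define S where "S t = suminf (\<lambda>i. f i t)" for t
  have ul: "uniform_limit {0..pi} (\<lambda>n t. \<Sum>i<n. f i t) S sequentially"
    unfolding S_def
    by (rule Weierstrass_m_test_ev[OF _ sum]) (use bound in \<open>auto simp: eventually_sequentially intro!: exI[of _ 1]\<close>)
  have cf: "continuous_on {0..pi} (f i)" for i
    unfolding f_def by (intro continuous_intros)
  have cS: "continuous_on {0..pi} S"
    by (rule uniform_limit_theorem[OF _ ul]) (auto intro!: continuous_intros cf always_eventually)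
  have int: "integral {0..pi} (\<lambda>t. S t * weighted_gegenbauer l n t) = moment n" for n
  proof -
    have bd: "bounded (u ` {0..pi})" if "continuous_on {0..pi} u" for u :: "real \<Rightarrow> real"
      by (rule compact_imp_bounded, rule compact_continuous_image[OF that]) simp
    have ul': "uniform_limit {0..pi} (\<lambda>m t. (\<Sum>i<m. f i t) * weighted_gegenbauer l n t) (\<lambda>t. S t * weighted_gegenbauer l n t) sequentially"
      by (rule uniform_lim_mult[OF ul uniform_limit_const bd[OF cS] bd[OF continuous_on_weighted_gegenbauer]])
    obtain I J where IJ: "\<And>m. ((\<lambda>t. (\<Sum>i<m. f i t) * weighted_gegenbauer l n t) has_integral I m) {0..pi}"
      "((\<lambda>t. S t * weighted_gegenbauer l n t) has_integral J) {0..pi}" "I \<longlonglongrightarrow> J"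
      by (rule uniform_limit_integral[OF ul']) (auto intro!: continuous_intros cf)
    \<comment> \<open>Once m > n the partial sum contains index n, and the other terms integrate to
      0.\<close>
    have "I m = moment n" if m: "m > n" for m
    proof -
      have "((\<lambda>t. \<Sum>i<m. fourier_coef i * (poly (gegenbauer l i) (cos t) * weighted_gegenbauer l n t)) has_integral
          (\<Sum>i<m. fourier_coef i * (if i = n then Z else 0))) {0..pi}"
      proof (intro has_integral_sum has_integral_mult_right)
        show "((\<lambda>t. poly (gegenbauer l i) (cos t) * weighted_gegenbauer l n t) has_integral (if i = n then Z else 0)) {0..pi}" for i
          using has_integral_gegenbauer_norm[OF l, of n] has_integral_gegenbauer_orthogonal[OF l, of i n]
          by (auto simp: Z_def)
      qed simp
      moreover have "(\<Sum>i<m. fourier_coef i * (if i = n then Z else 0)) = moment n"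
        using m Z by (simp add: fourier_coef_eq if_distrib cong: if_cong)
      moreover have "(\<lambda>t. \<Sum>i<m. fourier_coef i * (poly (gegenbauer l i) (cos t) * weighted_gegenbauer l n t)) = (\<lambda>t. (\<Sum>i<m. f i t) * weighted_gegenbauer l n t)"
        by (simp add: f_def sum_distrib_right mult.assoc)
      ultimately show ?thesis using IJ(1)[of m] has_integral_unique by metis
    qed
    then have "I \<longlonglongrightarrow> moment n"
      by (intro tendsto_eventually) (auto simp: eventually_sequentially intro!: exI[of _ "Suc n"])
    then have "J = moment n" using IJ(3) LIMSEQ_unique by blast
    then show ?thesis using IJ(2) by (simp add: integral_unique)
  qed
  have "H 0 t - S t = 0"
  proof (rule weighted_gegenbauer_complete[OF l _ _ t])
    show "continuous_on {0..pi} (\<lambda>t. H 0 t - S t)" by (intro continuous_intros cont cS) simp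
    fix n
    have "integral {0..pi} (\<lambda>t. H 0 t * weighted_gegenbauer l n t - S t * weighted_gegenbauer l n t) = moment n - moment n"
      by (subst integral_diff)
        (auto intro!: integrable_continuous_real continuous_intros cont cS simp: int moment_def)
    then show "integral {0..pi} (\<lambda>t. (H 0 t - S t) * weighted_gegenbauer l n t) = 0"
      by (simp add: left_diff_distrib)
  qed
  moreover have "(\<lambda>n. f n t) sums S t"
  proof -
    have "summable (\<lambda>n. f n t)"
      by (rule summable_comparison_test_ev[OF _ sum])
        (use bound t in \<open>auto simp: eventually_sequentially intro!: exI[of _ 1]\<close>)
    then show ?thesis by (simp add: S_def summable_sums)
  qed
  ultimately show ?thesis by (simp add: f_def)
qed

end

section \<open>Positive definiteness on the sphere\<close>

lemma inner_vec_coords: "inner x y = (\<Sum>i\<in>UNIV. x $ i * y $ i)" for x y :: "real ^ 'n"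
  by (simp add: inner_vec_def)

text \<open>\<open>gegenbauer l\<close> belongs to 2l + 2 variables. With 2l + 1 coordinates, an
  extra zero coordinate indexed by \<open>None\<close> embeds the points and preserves inner
  products.\<close>

lemma zonal_kernel_nonneg:
  fixes x :: "nat \<Rightarrow> real ^ 'n"
  assumes l: "l \<ge> 1" and d: "CARD('n) = 2 * l + 1 \<or> CARD('n) = 2 * l + 2"
    and x: "\<And>r. r \<in> A \<Longrightarrow> norm (x r) = 1"
  shows "(\<Sum>r\<in>A. \<Sum>s\<in>A. c r * poly (gegenbauer l n) (inner (x r) (x s)) * c s) \<ge> 0"
proof -
  have lead: "coeff (gegenbauer l n) n > 0" by (simp add: coeff_gegenbauer[OF l])
  have rec: "real (j + 2) * real (j + 1) * coeff (gegenbauer l n) (j + 2)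
      = (real j - real n) * (real j + real n + real C - 2) * coeff (gegenbauer l n) j" if "C = 2 * l + 2" for j C
  proof -
    have "real j + real n + real C - 2 = real j + real n + 2 * real l" using that by simp
    then show ?thesis using gegenbauer_coeff_rec by (simp only:)
  qed
  have sq: "(\<Sum>i\<in>UNIV. (x r $ i)\<^sup>2) = 1" if "r \<in> A" for r
  proof -
    have "inner (x r) (x r) = 1" using x[OF that] by (simp add: dot_square_norm)
    then show ?thesis by (simp add: inner_vec_coords power2_eq_square)
  qed
  from d show ?thesis
  proof
    assume d: "CARD('n) = 2 * l + 1"
    define y where "y r = case_option 0 (\<lambda>i. x r $ i)" for r
    have sum: "(\<Sum>i\<in>UNIV. f i) = f None + (\<Sum>i\<in>UNIV. f (Some i))" for f :: "'n option \<Rightarrow> real"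
      by (simp add: UNIV_option_conv sum.reindex)
    have card: "CARD('n option) = 2 * l + 2" using d by (simp add: card_UNIV_option)
    have "(\<Sum>r\<in>A. \<Sum>s\<in>A. c r * poly (gegenbauer l n) (\<Sum>i\<in>UNIV. y r i * y s i) * c s) \<ge> 0"
    proof (rule gegenbauer_kernel_nonneg[OF _ degree_gegenbauer lead])
      show "(\<Sum>i\<in>UNIV. (y r i)\<^sup>2) = 1" if "r \<in> A" for r
        using sq[OF that] by (simp add: sum y_def)
      show "real (j + 2) * real (j + 1) * coeff (gegenbauer l n) (j + 2)
        = (real j - real n) * (real j + real n + real CARD('n option) - 2) * coeff (gegenbauer l n) j" for j
        by (rule rec[OF card])
      show "CARD('n option) \<ge> 2" unfolding card by simp
    qed
    then show ?thesis by (simp add: sum y_def inner_vec_coords)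
  next
    assume d: "CARD('n) = 2 * l + 2"
    have "(\<Sum>r\<in>A. \<Sum>s\<in>A. c r * poly (gegenbauer l n) (\<Sum>i\<in>UNIV. x r $ i * x s $ i) * c s) \<ge> 0"
      by (rule gegenbauer_kernel_nonneg[OF sq degree_gegenbauer lead rec[OF d]]) (simp_all add: d)
    then show ?thesis by (simp add: inner_vec_coords)
  qed
qed

text \<open>The polynomials \<open>((1 + u) / 2) ^ N\<close> converge on \<open>[-1, 1]\<close> to the indicator of \<open>u = 1\<close>.\<close>

lemma poly_kernels_zero_imp_zero:
  fixes x :: "nat \<Rightarrow> 'a::real_inner"
  assumes fin: "finite A" and x: "\<And>r. r \<in> A \<Longrightarrow> norm (x r) = 1" and inj: "inj_on x A"
    and z: "\<And>p :: real poly. (\<Sum>r\<in>A. \<Sum>s\<in>A. c r * poly p (inner (x r) (x s)) * c s) = (0::real)"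
    and r: "r \<in> A"
  shows "c r = 0"
proof -
  define u where "u r s = (1 + inner (x r) (x s)) / 2" for r s
  have lim: "(\<lambda>N. u r s ^ N) \<longlonglongrightarrow> (if r = s then 1 else 0)" if rs: "r \<in> A" "s \<in> A" for r s
  proof (cases "r = s")
    case True
    then have "u r s = 1" using x[OF rs(1)] by (simp add: u_def dot_square_norm)
    then show ?thesis using True by simp
  next
    case False
    have "\<bar>inner (x r) (x s)\<bar> \<le> 1" using Cauchy_Schwarz_ineq2[of "x r" "x s"] x rs by simp
    moreover have "inner (x r) (x s) \<noteq> 1"
    proof
      assume "inner (x r) (x s) = 1"
      then have "x r = x s"
        using x[OF rs(1)] x[OF rs(2)] by (subst vector_eq) (simp add: dot_square_norm)
      then show False using inj rs False by (auto dest: inj_onD)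
    qed
    ultimately have "\<bar>u r s\<bar> < 1" by (auto simp: u_def abs_le_iff)
    then show ?thesis using False LIMSEQ_abs_realpow_zero2 by simp
  qed
  have lim_sum: "(\<lambda>N. \<Sum>r\<in>A. \<Sum>s\<in>A. c r * u r s ^ N * c s) \<longlonglongrightarrow> (\<Sum>r\<in>A. \<Sum>s\<in>A. c r * (if r = s then 1 else 0) * c s)"
    by (intro tendsto_intros lim)
  have "(\<Sum>r\<in>A. \<Sum>s\<in>A. c r * u r s ^ N * c s) = 0" for N
    using z[of "[:1/2, 1/2:] ^ N"] by (simp add: u_def poly_power add_divide_distrib)
  then have "(\<Sum>r\<in>A. \<Sum>s\<in>A. c r * (if r = s then 1 else 0) * c s) = 0"
    using lim_sum by (simp only: LIMSEQ_const_iff)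
  moreover have "(\<Sum>r\<in>A. \<Sum>s\<in>A. c r * (if r = s then 1 else 0) * c s) = (\<Sum>r\<in>A. c r * c r)"
    using fin by (intro sum.cong refl) (simp add: if_distrib if_distribR cong: if_cong)
  ultimately have "(\<Sum>r\<in>A. c r * c r) = 0" by simp
  then have "c r * c r = 0" using fin r by (subst (asm) sum_nonneg_eq_0_iff) auto
  then show ?thesis by simp
qed

theorem theorem2p3:
  fixes g :: "real \<Rightarrow> real" and d l :: nat
  assumes "d = CARD('n::finite)" and "d \<ge> 3"
    and "l = nat \<lceil>(real d - 2) / 2\<rceil>"
    and "continuous_on {0..pi} g"
    and "C_k_within l {0..pi} g"
    and "convex_on {0..pi} (\<lambda>x. (-1) ^ l * higher_deriv_within {0..pi} l g x)"
    and "\<forall>j\<le>l. higher_deriv_within {0..pi} j g pi = 0"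
    and "(higher_deriv_within {0..pi} l g has_real_derivative 0) (at pi within {0..pi})"
    and "\<exists>D. (higher_deriv_within {0..pi} l g has_real_derivative D) (at 0 within {0..pi})"
  shows "pos_def_fun_on (sphere 0 1 :: (real ^ 'n) set) g \<and>
    (\<not> linear_poly_on {0..pi} (higher_deriv_within {0..pi} l g) \<longrightarrow>
       strictly_pos_def_fun_on (sphere 0 1 :: (real ^ 'n) set) g)"
proof -
  define H where "H j = higher_deriv_within {0..pi} j g" for j
  obtain D where D: "(H l has_real_derivative D) (at 0 within {0..pi})"
    using assms(9) by (auto simp: H_def)
  \<comment> \<open>The ceiling gives d = 2l + 2 for even d and d = 2l + 1 for odd d.\<close>
  have dl: "d = 2 * l + 1 \<or> d = 2 * l + 2"
  proof (cases "even d")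
    case True
    then obtain m where m: "d = 2 * m" by (elim evenE)
    then have "(real d - 2) / 2 = of_int (int m - 1)" by simp
    then have "l = nat (int m - 1)" unfolding assms(3) by (simp only: ceiling_of_int)
    then show ?thesis using m assms(2) by auto
  next
    case False
    then obtain m where m: "d = 2 * m + 1" by (elim oddE)
    have "\<lceil>(real d - 2) / 2\<rceil> = int m" by (rule ceiling_unique) (simp_all add: m)
    then show ?thesis using m assms(3) by auto
  qed
  then have l: "l \<ge> 1" using assms(2) by auto
  interpret polya_profile H l D
  proof
    \<comment> \<open>Differentiability from \<open>C_k_within\<close> turns the value of
      \<open>vector_derivative\<close> into an actual derivative.\<close>
    show "(H j has_real_derivative H (Suc j) x) (at x within {0..pi})" if "j < l" "x \<in> {0..pi}" for j x
    proof -
      have "H j differentiable (at x within {0..pi})"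
        using assms(5) that by (auto simp: C_k_within_def differentiable_on_def H_def)
      then show ?thesis
        by (simp add: H_def has_real_derivative_iff_has_vector_derivative vector_derivative_works)
    qed
  qed (use l assms D in \<open>auto simp: H_def C_k_within_def\<close>)
  have H0: "H 0 = g" by (simp add: H_def)
  \<comment> \<open>The quadratic form is a series of nonnegative terms
    \<open>fourier_coef n * Q (gegenbauer l n)\<close>. If it is 0 while all coefficients are
    positive, Q vanishes on every \<open>gegenbauer l n\<close>, hence on all polynomials, and the
    weights are 0.\<close>
  have main: "0 \<le> (\<Sum>r=1..N. \<Sum>s=1..N. c r * g (geodesic_dist (x r) (x s)) * c s)
      \<and> ((\<Sum>r=1..N. \<Sum>s=1..N. c r * g (geodesic_dist (x r) (x s)) * c s) = 0
          \<longrightarrow> (\<exists>t\<in>{0..pi}. H l t \<noteq> 0) \<longrightarrow> (\<forall>r\<in>{1..N}. c r = 0))"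
    if x: "x ` {1..N} \<subseteq> sphere 0 1" and inj: "inj_on x {1..N}"
    for N :: nat and x :: "nat \<Rightarrow> real ^ 'n" and c :: "nat \<Rightarrow> real"
  proof -
    have nx: "norm (x r) = 1" if "r \<in> {1..N}" for r using x that by (auto simp: image_subset_iff)
    define Q where "Q p = (\<Sum>r=1..N. \<Sum>s=1..N. c r * poly p (inner (x r) (x s)) * c s)" for p
    define T where "T = (\<Sum>r=1..N. \<Sum>s=1..N. c r * g (geodesic_dist (x r) (x s)) * c s)"
    have Q0: "Q (gegenbauer l n) \<ge> 0" for n
      unfolding Q_def by (rule zonal_kernel_nonneg[OF l]) (use dl assms(1) nx in auto)
    have "(\<lambda>n. \<Sum>r=1..N. \<Sum>s=1..N. c r * (fourier_coef n * poly (gegenbauer l n) (inner (x r) (x s))) * c s) sums T"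
      unfolding T_def
    proof (intro sums_sum sums_mult sums_mult2)
      fix r s assume rs: "r \<in> {1..N}" "s \<in> {1..N}"
      have "\<bar>inner (x r) (x s)\<bar> \<le> 1" using Cauchy_Schwarz_ineq2[of "x r" "x s"] nx rs by simp
      then have "-1 \<le> inner (x r) (x s)" "inner (x r) (x s) \<le> 1" by (simp_all add: abs_le_iff)
      then have "geodesic_dist (x r) (x s) \<in> {0..pi}" "cos (geodesic_dist (x r) (x s)) = inner (x r) (x s)"
        by (simp_all add: geodesic_dist_def arccos_lbound arccos_ubound)
      then show "(\<lambda>n. fourier_coef n * poly (gegenbauer l n) (inner (x r) (x s))) sums g (geodesic_dist (x r) (x s))"
        using expansion_sums[of "geodesic_dist (x r) (x s)"] H0 by simp
    qed
    moreover have "(\<Sum>r=1..N. \<Sum>s=1..N. c r * (fourier_coef n * poly (gegenbauer l n) (inner (x r) (x s))) * c s) = fourier_coef n * Q (gegenbauer l n)" for n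
      by (simp add: Q_def sum_distrib_left mult_ac)
    ultimately have sums: "(\<lambda>n. fourier_coef n * Q (gegenbauer l n)) sums T" by simp
    have A0: "fourier_coef n \<ge> 0" for n using moment_nonneg by (simp add: fourier_coef_def)
    have nn: "fourier_coef n * Q (gegenbauer l n) \<ge> 0" for n using A0 Q0 by simp
    have "T \<ge> 0" using sums_le[OF nn sums_zero sums] .
    moreover have "\<forall>r\<in>{1..N}. c r = 0" if T: "T = 0" and ne: "\<exists>t\<in>{0..pi}. H l t \<noteq> 0"
    proof
      have "fourier_coef n > 0" for n using moment_pos[OF ne] by (simp add: fourier_coef_def)
      moreover have "fourier_coef n * Q (gegenbauer l n) = 0" for n
        using suminf_eq_zero_iff[OF sums_summable[OF sums] nn] sums_unique[OF sums] T by simp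
      ultimately have Qz: "Q (gegenbauer l n) = 0" for n by (metis less_irrefl mult_eq_0_iff)
      have "Q p = 0" for p
        by (rule gegenbauer_basis_induct[OF l])
          (simp_all add: Qz, simp_all add: Q_def sum.distrib sum_distrib_left algebra_simps)
      then show "c r = 0" if "r \<in> {1..N}" for r
        using poly_kernels_zero_imp_zero[of "{1..N}" x c r] nx inj that by (simp add: Q_def)
    qed
    ultimately show ?thesis unfolding T_def[symmetric] by (intro conjI impI)
  qed
  have sym: "symmetric_mat N (\<lambda>i j. g (geodesic_dist (x i) (x j)))" for N and x :: "nat \<Rightarrow> real ^ 'n"
    by (simp add: symmetric_mat_def geodesic_dist_def inner_commute)
  have "pos_def_fun_on (sphere 0 1 :: (real ^ 'n) set) g"
    unfolding pos_def_fun_on_def nonneg_definite_mat_def using main sym by blast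
  moreover have "strictly_pos_def_fun_on (sphere 0 1 :: (real ^ 'n) set) g"
    if nl: "\<not> linear_poly_on {0..pi} (higher_deriv_within {0..pi} l g)"
  proof -
    \<comment> \<open>The zero polynomial is linear, so a point exists where \<open>H l\<close> is
      nonzero, as \<open>moment_pos\<close> requires.\<close>
    have ne: "\<exists>t\<in>{0..pi}. H l t \<noteq> 0"
    proof (rule ccontr)
      assume "\<not> ?thesis"
      then have "linear_poly_on {0..pi} (higher_deriv_within {0..pi} l g)"
        unfolding linear_poly_on_def H_def by (intro exI[of _ 0]) auto
      then show False using nl by simp
    qed
    show ?thesis
      unfolding strictly_pos_def_fun_on_def pos_definite_mat_def
    proof (intro allI impI conjI sym)
      fix N and c :: "nat \<Rightarrow> real" and x :: "nat \<Rightarrow> real ^ 'n"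
      assume x: "x ` {1..N} \<subseteq> sphere 0 1 \<and> inj_on x {1..N}" and c: "\<exists>i\<in>{1..N}. c i \<noteq> 0"
      show "0 < (\<Sum>i=1..N. \<Sum>j=1..N. c i * g (geodesic_dist (x i) (x j)) * c j)"
      proof -
        have "\<not> (\<forall>r\<in>{1..N}. c r = 0)" using c by blast
        then have "(\<Sum>i=1..N. \<Sum>j=1..N. c i * g (geodesic_dist (x i) (x j)) * c j) \<noteq> 0"
          using conjunct2[OF main[OF conjunct1[OF x] conjunct2[OF x], of c]] ne by argo
        then show ?thesis
          using conjunct1[OF main[OF conjunct1[OF x] conjunct2[OF x], of c]] by (simp only: less_le simp_thms)
      qed
    qed
  qed
  ultimately show ?thesis by blast
qed

end
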